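(* Let $q$ be a power of a prime $p>2$, $s\ge1$, and let $N>1$ be an odd integer such that $N-1\mid q^s-1$ and $p\mid N$. Let $\Delta\subset\{0,1,\dots,N-1\}$ be a union of cyclotomic sets (with respect to $q$) with $0\in\Delta$ and $d(\Delta)=\max\Delta=(N-1)/2$. If $t$ is the number of consecutive exponents in $\Delta$, then there is a quantum error-correcting code (QECC) with parameters $[[n,\kappa,\ge\delta;0]]_q$, where $n=N+1$, $\kappa=N+1-2|\Delta|$ and $\delta=t+1$.
   Context: Cyclotomic sets. Let $\mathbb{Z}_N=\{0\}\cup\mathbb{Z}/\langle N-1\rangle$, where the classes of $\mathbb{Z}/\langle N-1\rangle$ are represented by $\{1,\dots,N-1\}$ (so $0$ and $N-1$ are distinct and $q\cdot0=0$); $\mathbb{Z}_N$ is identified with $\{0,1,\dots,N-1\}$. A cyclotomic set with respect to $q$ is a subset closed under $z\mapsto q\cdot z$. "The number $t$ of consecutive exponents in $\Delta$" means the maximal length of a run of consecutive integers contained in $\Delta$. Quantum code. A QECC is an entanglement-assisted code with $c=0$: with $H=\mathbb{C}^q$, a $[[n,\kappa,\ge\delta;0]]_q$ code is a subspace $Q\subset H^{\otimes n}$ of dimension $q^\kappa$ such that, with $P$ the orthogonal projector onto $Q$, $PEP\in\mathbb{C}P$ for every operator $E$ on $H^{\otimes n}$ acting nontrivially on fewer than $\delta$ of the $n$ qudits. *)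

theory Defs
  imports
    "HOL-Computational_Algebra.Primes"
    "Jordan_Normal_Form.VS_Connect"
    "Jordan_Normal_Form.Conjugate"
begin

text \<open>
  Multiplication by q on \<open>\<int>\<^sub>N = {0} \<union> \<int>/\<langle>N-1\<rangle>\<close>, identified with \<open>{0..N-1}\<close>: nonzero elements
  are residue classes modulo \<open>N - 1\<close> with representatives \<open>1, \<dots>, N-1\<close>, so a nonzero element
  whose multiple is divisible by \<open>N - 1\<close> is sent to \<open>N - 1\<close>, not to 0.
\<close>
definition cyc_mult :: "nat \<Rightarrow> nat \<Rightarrow> nat \<Rightarrow> nat" where
  "cyc_mult N q z =
     (if z = 0 then 0
      else if (N - 1) dvd q * z then N - 1
      else (q * z) mod (N - 1))"

definition cyclotomic_set :: "nat \<Rightarrow> nat \<Rightarrow> nat set \<Rightarrow> bool" where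
  "cyclotomic_set N q C \<longleftrightarrow> C \<subseteq> {0..N-1} \<and> (\<forall>z\<in>C. cyc_mult N q z \<in> C)"

text \<open>
  Only meaningful for finite sets, where the set of lengths below is finite and contains 0.
\<close>
definition num_consecutive :: "nat set \<Rightarrow> nat" where
  "num_consecutive D = Max {l. \<exists>a. {a..<a + l} \<subseteq> D}"

text \<open>
  The space \<open>(\<complex>\<^sup>q)\<^sup>\<otimes>\<^sup>n\<close> is represented by complex vectors of dimension \<open>q ^ n\<close>.  The index
  \<open>j < q ^ n\<close> stands for the product basis vector \<open>|x\<^sub>0\<rangle> \<otimes> \<dots> \<otimes> |x\<^sub>n\<^sub>-\<^sub>1\<rangle>\<close>, where
  \<open>x\<^sub>i = qudit q j i\<close> is the i-th base-q digit of j.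
\<close>
definition qudit :: "nat \<Rightarrow> nat \<Rightarrow> nat \<Rightarrow> nat" where
  "qudit q j i = (j div q ^ i) mod q"

text \<open>
  E has the form \<open>A\<^sub>S \<otimes> I\<close>, with \<open>A\<^sub>S\<close> an arbitrary operator on the qudits in S (given by its
  matrix entries) and I the identity on the remaining qudits.
\<close>
definition acts_within :: "nat \<Rightarrow> nat \<Rightarrow> nat set \<Rightarrow> complex mat \<Rightarrow> bool" where
  "acts_within q n S E \<longleftrightarrow>
     E \<in> carrier_mat (q ^ n) (q ^ n) \<and>
     (\<exists>A :: (nat \<Rightarrow> nat) \<Rightarrow> (nat \<Rightarrow> nat) \<Rightarrow> complex.
        \<forall>j<q ^ n. \<forall>k<q ^ n.
          E $$ (j, k) =
            (if \<forall>i\<in>{..<n} - S. qudit q j i = qudit q k i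
             then A (restrict (qudit q j) S) (restrict (qudit q k) S)
             else 0))"

definition orthogonal_projector :: "nat \<Rightarrow> complex vec set \<Rightarrow> complex mat \<Rightarrow> bool" where
  "orthogonal_projector m Q P \<longleftrightarrow>
     P \<in> carrier_mat m m \<and>
     (\<forall>v\<in>carrier_vec m. P *\<^sub>v v \<in> Q \<and> (\<forall>w\<in>Q. (v - P *\<^sub>v v) \<bullet>c w = 0))"

text \<open>
  Q is an \<open>[[n, \<kappa>, \<ge>\<delta>; 0]]\<^sub>q\<close> code.
\<close>
definition qecc :: "nat \<Rightarrow> nat \<Rightarrow> nat \<Rightarrow> nat \<Rightarrow> complex vec set \<Rightarrow> bool" where
  "qecc q n \<kappa> \<delta> Q \<longleftrightarrow>
     subspace class_ring Q (module_vec TYPE(complex) (q ^ n)) \<and>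
     vectorspace.dim class_ring
       ((module_vec TYPE(complex) (q ^ n))\<lparr>carrier := Q\<rparr>) = q ^ \<kappa> \<and>
     (\<exists>P. orthogonal_projector (q ^ n) Q P \<and>
        (\<forall>S E. S \<subseteq> {..<n} \<longrightarrow> card S < \<delta> \<longrightarrow> acts_within q n S E \<longrightarrow>
           (\<exists>c. P * E * P = c \<cdot>\<^sub>m P)))"

end

theory Submission
  imports "HOL-Algebra.Algebraic_Closure" "HOL-Number_Theory.Residues" Defs
begin

text \<open>
  Let \<open>m = (N - 1) / 2\<close>.  Over \<open>K = GF(q^s)\<close>, evaluate the polynomials with exponents in \<open>\<Delta>\<close> at 0
  and at the \<open>(N - 1)\<close>-th roots of unity, and append the coefficient of \<open>X^m\<close> as one more coordinate.
  As \<open>p\<close> divides \<open>N\<close> and \<open>max \<Delta> = m\<close>, the power sums of the \<open>N\<close> points vanish except that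
  \<open>X^m\<close> paired with itself gives \<open>N - 1 = -1\<close>, which the extra coordinate cancels: the extended code
  is self-orthogonal.  It is stable under the Frobenius map because \<open>\<Delta>\<close> is a union of cyclotomic
  sets, so it has a basis over \<open>GF(q)\<close> and its subfield subcode \<open>C\<close> has dimension \<open>|\<Delta>|\<close>.
  Lagrange interpolation along a run of \<open>t\<close> consecutive exponents shows that \<open>C\<close> takes arbitrary
  values on any \<open>t\<close> coordinates, i.e. that the dual code has minimum distance greater than \<open>t\<close>.
  The quantum code is spanned by the sums of the basis vectors over the cosets of \<open>C\<close> in its dual;
  an error on at most \<open>t\<close> qudits restricts to a scalar there, since distinct words of the dual differ
  in more than \<open>t\<close> places and every coset has the same restrictions to any \<open>t\<close> places.
\<close>

section \<open>Quantum codes from partitions of the computational basis\<close>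

text \<open>The obstacle is that interpolation over K yields words with entries in K, while the
  qudits carry GF(q). Dimension and interpolation are therefore both expressed through information
  sets: a coordinate set on which all values can be prescribed extends to one, every information set
  of V is one of C, and its size is |\<Delta>|. No basis over GF(q) is ever constructed. The
  constants fit together as follows. The point 0 joins the roots of unity so that the exponent 0 has
  power sum N = 0 in K. Exponents a, b <= m reach a + b = N - 1 only for a = b = m, so one extra
  coordinate repairs everything. As q is odd, q m is m modulo N - 1, which makes that coordinate
  compatible with Frobenius. When the extra coordinate is one of those to be prescribed, the last
  exponent of the run is given up; the rest misses m = max \<Delta>, so the coefficient of X^m can
  be chosen freely. On the quantum side an arbitrary operator on S is handled through its matrix
  entries, without a decomposition into an error basis.\<close>

lemma mult_mat_index_sum:
  assumes "A \<in> carrier_mat d d" "B \<in> carrier_mat d d" "i < d" "j < d"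
  shows "(A * B) $$ (i, j) = (\<Sum>k = 0..<d. A $$ (i, k) * B $$ (k, j))"
  using assms by (auto simp: scalar_prod_def intro!: sum.cong)

text \<open>The abstract form of the cosets of C in its dual, written as sets of basis indices, with
  M = |C|. Equal block sizes give all block averages the same denominator.\<close>

locale block_code =
  fixes d M :: nat and \<P> :: "nat set set"
  assumes blocks_disjoint: "B \<in> \<P> \<Longrightarrow> B' \<in> \<P> \<Longrightarrow> B \<noteq> B' \<Longrightarrow> B \<inter> B' = {}"
    and blocks_sub: "\<Union>\<P> \<subseteq> {..<d}"
    and card_block: "B \<in> \<P> \<Longrightarrow> card B = M"
    and M_pos: "M > 0"
begin

lemma finite_block: "B \<in> \<P> \<Longrightarrow> finite B"
  using card_block M_pos by (metis card.infinite less_irrefl)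

lemma block_lt: "B \<in> \<P> \<Longrightarrow> x \<in> B \<Longrightarrow> x < d"
  using blocks_sub by auto

lemma finite_blocks: "finite \<P>"
proof -
  have "\<P> \<subseteq> Pow {..<d}" using blocks_sub by blast
  then show ?thesis by (rule finite_subset) simp
qed

lemma block_eq: "B \<in> \<P> \<Longrightarrow> B' \<in> \<P> \<Longrightarrow> x \<in> B \<Longrightarrow> x \<in> B' \<Longrightarrow> B = B'"
  using blocks_disjoint by blast

text \<open>This is the span of the block indicators, given by equations so that closure and
  orthogonality can be checked entrywise; the proof of \<open>dim_code\<close> recovers the
  span.\<close>

definition code :: "complex vec set" where
  "code = {v \<in> carrier_vec d. (\<forall>x<d. x \<notin> \<Union>\<P> \<longrightarrow> v $ x = 0) \<and>
     (\<forall>B\<in>\<P>. \<forall>x\<in>B. \<forall>y\<in>B. v $ x = v $ y)}"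

text \<open>The sum of the rank-one projectors onto the block indicators: it averages a vector over
  each block and erases it elsewhere.\<close>

definition proj :: "complex mat" where
  "proj = mat d d (\<lambda>(x, y). if \<exists>B\<in>\<P>. x \<in> B \<and> y \<in> B then 1 / of_nat M else 0)"

definition block_vec :: "nat set \<Rightarrow> complex vec" where
  "block_vec B = vec d (\<lambda>x. if x \<in> B then 1 else 0)"

lemma proj_carrier [simp]: "proj \<in> carrier_mat d d"
  by (simp add: proj_def)

lemma proj_dim [simp]: "dim_row proj = d" "dim_col proj = d"
  by (simp_all add: proj_def)

lemma proj_entry: "B \<in> \<P> \<Longrightarrow> x \<in> B \<Longrightarrow> y < d \<Longrightarrow>
    proj $$ (x, y) = (if y \<in> B then 1 / of_nat M else 0)"
  using block_eq block_lt by (fastforce simp: proj_def)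

lemma proj_entry': "B \<in> \<P> \<Longrightarrow> y \<in> B \<Longrightarrow> x < d \<Longrightarrow>
    proj $$ (x, y) = (if x \<in> B then 1 / of_nat M else 0)"
  using block_eq block_lt by (fastforce simp: proj_def)

lemma proj_entry_outside: "x \<notin> \<Union>\<P> \<Longrightarrow> x < d \<Longrightarrow> y < d \<Longrightarrow> proj $$ (x, y) = 0"
  by (auto simp: proj_def)

lemma proj_entry_outside': "y \<notin> \<Union>\<P> \<Longrightarrow> x < d \<Longrightarrow> y < d \<Longrightarrow> proj $$ (x, y) = 0"
  by (auto simp: proj_def)

lemma sum_restrict_block:
  fixes f :: "nat \<Rightarrow> complex"
  assumes "B \<in> \<P>"
  shows "(\<Sum>y = 0..<d. (if y \<in> B then f y else 0)) = sum f B"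
proof -
  have "{0..<d} \<inter> B = B" using block_lt[OF assms] by auto
  then show ?thesis by (simp add: sum.inter_restrict[symmetric])
qed

lemma proj_mult_vec:
  assumes v: "v \<in> carrier_vec d" and x: "x < d"
  shows "B \<in> \<P> \<Longrightarrow> x \<in> B \<Longrightarrow> (proj *\<^sub>v v) $ x = (\<Sum>y\<in>B. v $ y) / of_nat M"
    and "x \<notin> \<Union>\<P> \<Longrightarrow> (proj *\<^sub>v v) $ x = 0"
proof -
  have *: "(proj *\<^sub>v v) $ x = (\<Sum>y = 0..<d. proj $$ (x, y) * v $ y)"
    using v x proj_carrier by (auto simp: scalar_prod_def intro!: sum.cong)
  show "(proj *\<^sub>v v) $ x = (\<Sum>y\<in>B. v $ y) / of_nat M" if B: "B \<in> \<P>" "x \<in> B"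
  proof -
    have "(proj *\<^sub>v v) $ x = (\<Sum>y = 0..<d. (if y \<in> B then v $ y / of_nat M else 0))"
      unfolding * by (rule sum.cong) (auto simp: proj_entry[OF B])
    then show ?thesis using sum_restrict_block[OF B(1)] by (simp add: sum_divide_distrib)
  qed
  show "(proj *\<^sub>v v) $ x = 0" if "x \<notin> \<Union>\<P>"
    unfolding * using that x by (auto intro!: sum.neutral simp: proj_entry_outside)
qed

lemma proj_in_code: "v \<in> carrier_vec d \<Longrightarrow> proj *\<^sub>v v \<in> code"
  unfolding code_def
  by (auto simp: proj_mult_vec block_lt simp del: index_mult_mat_vec
      intro!: mult_mat_vec_carrier[OF proj_carrier])

lemma sum_zero_on_blocks:
  fixes f :: "nat \<Rightarrow> complex"
  assumes "\<And>x. x < d \<Longrightarrow> x \<notin> \<Union>\<P> \<Longrightarrow> f x = 0" and "\<And>B. B \<in> \<P> \<Longrightarrow> sum f B = 0"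
  shows "(\<Sum>x = 0..<d. f x) = 0"
proof -
  have "(\<Sum>x = 0..<d. f x) = sum f (\<Union>\<P>)"
    using blocks_sub assms(1) by (intro sum.mono_neutral_right) auto
  also have "\<dots> = (\<Sum>B\<in>\<P>. sum f B)"
    using finite_block blocks_disjoint by (intro sum.Union_disjoint[unfolded comp_def]) auto
  finally show ?thesis using assms(2) by simp
qed

text \<open>On a block w is constant, so the block contributes the conjugate of that constant times
  the sum of v minus its block average, which is 0.\<close>

lemma orthogonal_proj: "orthogonal_projector d code proj"
  unfolding orthogonal_projector_def
proof (intro conjI ballI)
  fix v :: "complex vec" assume v: "v \<in> carrier_vec d"
  show "proj *\<^sub>v v \<in> code" by (rule proj_in_code[OF v])
  fix w assume w: "w \<in> code"
  then have wc: "w \<in> carrier_vec d" by (simp add: code_def)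
  have pv: "proj *\<^sub>v v \<in> carrier_vec d" using mult_mat_vec_carrier[OF proj_carrier v] .
  have "(v - proj *\<^sub>v v) \<bullet>c w = (\<Sum>x = 0..<d. (v $ x - (proj *\<^sub>v v) $ x) * cnj (w $ x))"
    using v wc pv by (auto simp: scalar_prod_def intro!: sum.cong)
  also have "\<dots> = 0"
  proof (rule sum_zero_on_blocks)
    fix x assume "x < d" "x \<notin> \<Union>\<P>"
    then show "(v $ x - (proj *\<^sub>v v) $ x) * cnj (w $ x) = 0"
      using w by (simp add: code_def)
  next
    fix B assume B: "B \<in> \<P>"
    then obtain b where b: "b \<in> B"
      using card_block M_pos by fastforce
    have "(\<Sum>x\<in>B. (v $ x - (proj *\<^sub>v v) $ x) * cnj (w $ x))
        = (\<Sum>x\<in>B. (v $ x - (\<Sum>y\<in>B. v $ y) / of_nat M) * cnj (w $ b))"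
    proof (rule sum.cong[OF refl])
      fix x assume x: "x \<in> B"
      have "w $ x = w $ b" using w B b x unfolding code_def by blast
      then show "(v $ x - (proj *\<^sub>v v) $ x) * cnj (w $ x)
        = (v $ x - (\<Sum>y\<in>B. v $ y) / of_nat M) * cnj (w $ b)"
        using proj_mult_vec(1)[OF v block_lt[OF B x] B x] by simp
    qed
    also have "\<dots> = (\<Sum>x\<in>B. v $ x - (\<Sum>y\<in>B. v $ y) / of_nat M) * cnj (w $ b)"
      by (rule sum_distrib_right[symmetric])
    also have "(\<Sum>x\<in>B. v $ x - (\<Sum>y\<in>B. v $ y) / of_nat M) = 0"
      using card_block[OF B] M_pos by (simp add: sum_subtractf)
    finally show "(\<Sum>x\<in>B. (v $ x - (proj *\<^sub>v v) $ x) * cnj (w $ x)) = 0" by simp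
  qed
  finally show "(v - proj *\<^sub>v v) \<bullet>c w = 0" .
qed simp

lemma subspace_code: "subspace class_ring code (module_vec TYPE(complex) d)"
proof -
  interpret vec_space "TYPE(complex)" d .
  show ?thesis
    unfolding subspace_def submodule_def
  proof (intro conjI allI impI)
    show "vectorspace class_ring V" by (rule vec_vs)
    show "module class_ring V" by (rule vec_module)
    show "code \<subseteq> carrier V" by (auto simp: code_def)
    show "\<zero>\<^bsub>V\<^esub> \<in> code" using block_lt by (auto simp: code_def)
  next
    fix v w assume vw: "v \<in> code" "w \<in> code"
    then have c: "v \<in> carrier_vec d" "w \<in> carrier_vec d" by (auto simp: code_def)
    have "v + w \<in> code"
      unfolding code_def
    proof (intro CollectI conjI ballI allI impI)
      fix B x y assume h: "B \<in> \<P>" "x \<in> B" "y \<in> B"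
      then have "v $ x = v $ y" "w $ x = w $ y" using vw unfolding code_def by blast+
      then show "(v + w) $ x = (v + w) $ y" using c block_lt h by simp
    qed (use vw c in \<open>auto simp: code_def\<close>)
    then show "v \<oplus>\<^bsub>V\<^esub> w \<in> code" by simp
  next
    fix a :: complex and v assume vw: "v \<in> code"
    then have c: "v \<in> carrier_vec d" by (auto simp: code_def)
    have "a \<cdot>\<^sub>v v \<in> code"
      unfolding code_def
    proof (intro CollectI conjI ballI allI impI)
      fix B x y assume h: "B \<in> \<P>" "x \<in> B" "y \<in> B"
      then have "v $ x = v $ y" using vw unfolding code_def by blast+
      then show "(a \<cdot>\<^sub>v v) $ x = (a \<cdot>\<^sub>v v) $ y" using c block_lt h by simp
    qed (use vw c in \<open>auto simp: code_def\<close>)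
    then show "a \<odot>\<^bsub>V\<^esub> v \<in> code" by simp
  qed
qed

lemma block_vec_index:
  "x < d \<Longrightarrow> block_vec B $ x = (if x \<in> B then 1 else 0)"
  by (simp add: block_vec_def)

lemma block_vec_in_code: "B \<in> \<P> \<Longrightarrow> block_vec B \<in> code"
  unfolding code_def using block_lt by (auto simp: block_vec_def dest: block_eq)

lemma inj_block_vec: "inj_on block_vec \<P>"
proof (rule inj_onI)
  fix B B' assume B: "B \<in> \<P>" "B' \<in> \<P>" and eq: "block_vec B = block_vec B'"
  obtain b where b: "b \<in> B" using B card_block M_pos by fastforce
  have "block_vec B' $ b = 1" using eq block_vec_index[of b B] block_lt[OF B(1) b] b by metis
  then have "b \<in> B'" using block_vec_index[of b B'] block_lt[OF B(1) b]
    by (auto split: if_splits)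
  then show "B = B'" using block_eq B b by blast
qed

lemma dim_code:
  "vectorspace.dim class_ring ((module_vec TYPE(complex) d)\<lparr>carrier := code\<rparr>) = card \<P>"
proof -
  interpret vec_space "TYPE(complex)" d .
  interpret W: vectorspace class_ring "vs code"
    by (rule subspace_is_vs[OF subspace_code])
  let ?A = "block_vec ` \<P>"
  have sm: "submodule class_ring code V" using subspace_code by (simp add: subspace_def)
  have sub: "?A \<subseteq> code" using block_vec_in_code by auto
  have subc: "?A \<subseteq> carrier_vec d" by (auto simp: block_vec_def)
  have fin: "finite ?A" using finite_blocks by simp
  have index: "lincomb a ?A $ x = a (block_vec B)" if "B \<in> \<P>" "x \<in> B" for a B x
  proof -
    have x: "x < d" using block_lt that by blast
    have "lincomb a ?A $ x = (\<Sum>C\<in>\<P>. a (block_vec C) * block_vec C $ x)"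
      unfolding lincomb_index[OF x subc] by (simp add: sum.reindex[OF inj_block_vec])
    also have "\<dots> = (\<Sum>C\<in>\<P>. if C = B then a (block_vec B) else 0)"
      using x that block_eq by (intro sum.cong) (auto simp: block_vec_index)
    finally show ?thesis using that finite_blocks by simp
  qed
  have outside: "lincomb a ?A $ x = 0" if "x < d" "x \<notin> \<Union>\<P>" for a x
    unfolding lincomb_index[OF that(1) subc]
    using that by (intro sum.neutral) (auto simp: block_vec_index)
  have li: "\<not> lin_dep ?A"
  proof (rule finite_lin_indpt2)
    fix a :: "complex vec \<Rightarrow> complex" assume z: "lincomb a ?A = 0\<^sub>v d"
    show "\<forall>v\<in>?A. a v = 0"
    proof clarify
      fix B assume B: "B \<in> \<P>"
      then obtain b where b: "b \<in> B" using card_block M_pos by fastforce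
      have "a (block_vec B) = lincomb a ?A $ b" using index[OF B b] by simp
      also have "\<dots> = 0" using z block_lt[OF B b] by simp
      finally show "a (block_vec B) = 0" .
    qed
  qed (use fin subc in auto)
  have sp: "span ?A = code"
  proof
    show "span ?A \<subseteq> code" by (rule span_is_subset[OF sub sm])
    show "code \<subseteq> span ?A"
    proof
      fix v assume v: "v \<in> code"
      \<comment> \<open>The coefficient of a block indicator is the common value of v on that block,
        read off at an arbitrary element. Linear combinations are indexed by vectors, so
        \<open>inv_into\<close> recovers the block.\<close>
      define a where "a u = v $ (SOME x. x \<in> inv_into \<P> block_vec u)" for u
      have "v = lincomb a ?A"
      proof (rule eq_vecI)
        have dl: "dim_vec (lincomb a ?A) = d" by (rule lincomb_dim[OF fin subc])
        show "dim_vec v = dim_vec (lincomb a ?A)" using v dl by (auto simp: code_def)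
        fix x assume "x < dim_vec (lincomb a ?A)"
        then have x: "x < d" using dl by simp
        show "v $ x = lincomb a ?A $ x"
        proof (cases "x \<in> \<Union>\<P>")
          case True
          then obtain B where B: "B \<in> \<P>" "x \<in> B" by blast
          have "(SOME x. x \<in> B) \<in> B" using B(2) by (rule someI)
          then have "v $ (SOME x. x \<in> B) = v $ x" using v B unfolding code_def by blast
          then show ?thesis
            using index[OF B] inj_block_vec B(1) by (simp add: a_def)
        qed (use v x outside in \<open>auto simp: code_def\<close>)
      qed
      then show "v \<in> span ?A" unfolding span_def using fin by auto
    qed
  qed
  have "W.basis ?A"
    unfolding W.basis_def
    using span_li_not_depend[OF sub sm] li sp sub by auto
  then have "W.dim = card ?A" by (rule W.dim_basis[OF fin])
  then show ?thesis using card_image[OF inj_block_vec] by simp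
qed

text \<open>For x in B and y in B' the entry of the product is 1/M^2 times the sum of E over all
  pairs from B and B'. By \<open>diag\<close> this is the trace of E over B if B = B', and 0
  otherwise.\<close>

lemma proj_sandwich:
  assumes E: "E \<in> carrier_mat d d"
    and diag: "\<And>u v. u \<in> \<Union>\<P> \<Longrightarrow> v \<in> \<Union>\<P> \<Longrightarrow> u \<noteq> v \<Longrightarrow> E $$ (u, v) = 0"
    and trace: "\<And>B. B \<in> \<P> \<Longrightarrow> (\<Sum>u\<in>B. E $$ (u, u)) = T"
  shows "proj * E * proj = (T / of_nat M) \<cdot>\<^sub>m proj"
proof (rule eq_matI)
  have pe: "proj * E \<in> carrier_mat d d" using mult_carrier_mat[OF proj_carrier E] .
  fix x y assume "x < dim_row ((T / of_nat M) \<cdot>\<^sub>m proj)" "y < dim_col ((T / of_nat M) \<cdot>\<^sub>m proj)"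
  then have x: "x < d" and y: "y < d" by (simp_all add: proj_def)
  have pe_entry: "(proj * E) $$ (x, v) = (\<Sum>u = 0..<d. proj $$ (x, u) * E $$ (u, v))"
    if "v < d" for v
    by (rule mult_mat_index_sum[OF proj_carrier E x that])
  have eq: "(proj * E * proj) $$ (x, y) = (\<Sum>v = 0..<d. (proj * E) $$ (x, v) * proj $$ (v, y))"
    by (rule mult_mat_index_sum[OF pe proj_carrier x y])
  show "(proj * E * proj) $$ (x, y) = ((T / of_nat M) \<cdot>\<^sub>m proj) $$ (x, y)"
  proof (cases "x \<in> \<Union>\<P> \<and> y \<in> \<Union>\<P>")
    case False
    have "(proj * E) $$ (x, v) * proj $$ (v, y) = 0" if "v < d" for v
    proof (cases "x \<in> \<Union>\<P>")
      case True
      then show ?thesis using False that y proj_entry_outside' by simp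
    next
      case False
      then show ?thesis unfolding pe_entry[OF that] using x that proj_entry_outside by simp
    qed
    then have "(proj * E * proj) $$ (x, y) = 0"
      unfolding eq by (intro sum.neutral) auto
    moreover have "proj $$ (x, y) = 0"
      using False x y proj_entry_outside proj_entry_outside' by metis
    ultimately show ?thesis using x y by (simp add: proj_def)
  next
    case True
    then obtain B B' where B: "B \<in> \<P>" "x \<in> B" and B': "B' \<in> \<P>" "y \<in> B'" by blast
    have "(proj * E) $$ (x, v) = (\<Sum>u\<in>B. E $$ (u, v)) / of_nat M" if "v < d" for v
    proof -
      have "(proj * E) $$ (x, v) = (\<Sum>u = 0..<d. (if u \<in> B then E $$ (u, v) / of_nat M else 0))"
        unfolding pe_entry[OF that] by (rule sum.cong) (auto simp: proj_entry[OF B])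
      then show ?thesis using sum_restrict_block[OF B(1)] by (simp add: sum_divide_distrib)
    qed
    then have "(proj * E * proj) $$ (x, y)
        = (\<Sum>v = 0..<d. (if v \<in> B' then (\<Sum>u\<in>B. E $$ (u, v)) / of_nat M / of_nat M else 0))"
      unfolding eq by (intro sum.cong) (auto simp: proj_entry'[OF B'])
    also have "\<dots> = (\<Sum>v\<in>B'. (\<Sum>u\<in>B. E $$ (u, v)) / of_nat M / of_nat M)"
      by (rule sum_restrict_block[OF B'(1)])
    also have "\<dots> = (\<Sum>v\<in>B'. (if v \<in> B then E $$ (v, v) else 0) / of_nat M / of_nat M)"
    proof (rule sum.cong[OF refl])
      fix v assume v: "v \<in> B'"
      have "(\<Sum>u\<in>B. E $$ (u, v)) = (\<Sum>u\<in>B. if u = v then E $$ (v, v) else 0)"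
        using diag v B B' by (intro sum.cong) auto
      then show "(\<Sum>u\<in>B. E $$ (u, v)) / of_nat M / of_nat M
        = (if v \<in> B then E $$ (v, v) else 0) / of_nat M / of_nat M"
        using finite_block[OF B(1)] by simp
    qed
    also have "\<dots> = (if B = B' then T / of_nat M / of_nat M else 0)"
    proof (cases "B = B'")
      case True
      then show ?thesis
        using trace[OF B(1)] by (simp add: sum_divide_distrib[symmetric] cong: sum.cong)
    next
      case False
      then have "v \<notin> B" if "v \<in> B'" for v using block_eq[OF B(1) B'(1)] that by blast
      then show ?thesis using False by (simp cong: sum.cong)
    qed
    finally show ?thesis
      using x y B B' block_eq by (auto simp: proj_entry[OF B] proj_def[symmetric] carrier_matD[OF proj_carrier])
  qed
qed (use E in \<open>auto simp: proj_def\<close>)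

end

text \<open>The assumptions are the two halves of the Knill-Laflamme condition. A nonzero entry of E
  between distinct u and v requires agreement off S, which \<open>separated\<close> excludes. A
  diagonal entry depends only on the digits in S, which \<open>alike\<close> matches between blocks,
  so all blocks have the same trace.\<close>

lemma qecc_of_blocks:
  fixes q n \<kappa> \<delta> M :: nat and \<P> :: "nat set set"
  assumes part: "block_code (q ^ n) M \<P>"
    and card: "card \<P> = q ^ \<kappa>" and q: "q > 0"
    and separated: "\<And>S u v. S \<subseteq> {..<n} \<Longrightarrow> card S < \<delta> \<Longrightarrow> u \<in> \<Union>\<P> \<Longrightarrow> v \<in> \<Union>\<P> \<Longrightarrow>
          \<forall>i\<in>{..<n} - S. qudit q u i = qudit q v i \<Longrightarrow> u = v"
    and alike: "\<And>S B B'. S \<subseteq> {..<n} \<Longrightarrow> card S < \<delta> \<Longrightarrow> B \<in> \<P> \<Longrightarrow> B' \<in> \<P> \<Longrightarrow>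
          \<exists>h. bij_betw h B B' \<and> (\<forall>u\<in>B. \<forall>i\<in>S. qudit q (h u) i = qudit q u i)"
  shows "\<exists>Q. qecc q n \<kappa> \<delta> Q"
proof -
  interpret block_code "q ^ n" M \<P> by (rule part)
  have "qecc q n \<kappa> \<delta> code"
    unfolding qecc_def
  proof (intro conjI exI[of _ proj] allI impI)
    fix S :: "nat set" and E assume S: "S \<subseteq> {..<n}" "card S < \<delta>" and E: "acts_within q n S E"
    then obtain A where Ec: "E \<in> carrier_mat (q ^ n) (q ^ n)" and A:
      "\<And>j k. j < q ^ n \<Longrightarrow> k < q ^ n \<Longrightarrow> E $$ (j, k) =
            (if \<forall>i\<in>{..<n} - S. qudit q j i = qudit q k i
             then A (restrict (qudit q j) S) (restrict (qudit q k) S) else 0)"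
      unfolding acts_within_def by auto
    have diag: "E $$ (u, v) = 0" if "u \<in> \<Union>\<P>" "v \<in> \<Union>\<P>" "u \<noteq> v" for u v
      using separated[OF S that(1,2)] that block_lt A[of u v] by auto
    have "\<P> \<noteq> {}" using card q by auto
    then obtain B0 where B0: "B0 \<in> \<P>" by blast
    have "(\<Sum>u\<in>B. E $$ (u, u)) = (\<Sum>u\<in>B0. E $$ (u, u))" if B: "B \<in> \<P>" for B
    proof -
      obtain h where h: "bij_betw h B B0" "\<forall>u\<in>B. \<forall>i\<in>S. qudit q (h u) i = qudit q u i"
        using alike[OF S B B0] by blast
      have "E $$ (h u, h u) = E $$ (u, u)" if u: "u \<in> B" for u
      proof -
        have "h u \<in> B0" using h(1) u by (auto simp: bij_betw_def)
        moreover have "restrict (qudit q (h u)) S = restrict (qudit q u) S"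
          using h(2) u by (auto simp: restrict_def)
        ultimately show ?thesis using A u B B0 block_lt by simp
      qed
      then show ?thesis
        using sum.reindex_bij_betw[OF h(1), of "\<lambda>u. E $$ (u, u)"] by (simp cong: sum.cong)
    qed
    then show "\<exists>c. proj * E * proj = c \<cdot>\<^sub>m proj"
      using proj_sandwich[OF Ec diag] by blast
  qed (use subspace_code orthogonal_proj dim_code card in auto)
  then show ?thesis by blast
qed

section \<open>Linear codes over a subfield\<close>

text \<open>Words are extensional functions, so agreement on A is equality. Keeping the alphabet F
  as a subfield of an ambient field lets the same theory serve the code over the whole field, its
  subfield subcode and the dual.\<close>

locale linear_code = field R for R (structure) +
  fixes F :: "'a set" and A :: "'i set" and V :: "('i \<Rightarrow> 'a) set"
  assumes F: "subfield F R" and finite_A: "finite A"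
    and V_sub: "V \<subseteq> A \<rightarrow>\<^sub>E F"
    and zero_word: "(\<lambda>i\<in>A. \<zero>) \<in> V"
    and combine: "u \<in> V \<Longrightarrow> v \<in> V \<Longrightarrow> c \<in> F \<Longrightarrow> (\<lambda>i\<in>A. u i \<oplus> c \<otimes> v i) \<in> V"
begin

lemma F_sub: "x \<in> F \<Longrightarrow> x \<in> carrier R"
  using subfieldE(3)[OF F] by auto

lemma F_closed [simp]:
  "\<zero> \<in> F" "\<one> \<in> F"
  "x \<in> F \<Longrightarrow> y \<in> F \<Longrightarrow> x \<oplus> y \<in> F"
  "x \<in> F \<Longrightarrow> y \<in> F \<Longrightarrow> x \<otimes> y \<in> F"
  "x \<in> F \<Longrightarrow> \<ominus> x \<in> F"
  "x \<in> F \<Longrightarrow> x \<noteq> \<zero> \<Longrightarrow> inv x \<in> F"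
  using subringE[OF subfieldE(1)[OF F]] subfield_m_inv(1)[OF F] by auto

lemma F_finsum: "(\<And>i. i \<in> J \<Longrightarrow> f i \<in> F) \<Longrightarrow> (\<Oplus>i\<in>J. f i) \<in> F"
proof (induction J rule: infinite_finite_induct)
  case (insert x J)
  then have "f \<in> J \<rightarrow> carrier R" "f x \<in> carrier R" using F_sub by auto
  then show ?case using insert by simp
qed auto

lemma word_in_F: "v \<in> V \<Longrightarrow> i \<in> A \<Longrightarrow> v i \<in> F"
  using V_sub by auto

lemma word_closed: "v \<in> V \<Longrightarrow> i \<in> A \<Longrightarrow> v i \<in> carrier R"
  using word_in_F F_sub by auto

lemma word_eqI: "u \<in> V \<Longrightarrow> v \<in> V \<Longrightarrow> (\<And>i. i \<in> A \<Longrightarrow> u i = v i) \<Longrightarrow> u = v"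
  using V_sub by (meson PiE_ext subsetD)

text \<open>These are the independent sets of the matroid on the columns of a generator matrix; the
  information sets below are its bases.\<close>

definition interpolates :: "'i set \<Rightarrow> bool" where
  "interpolates S \<longleftrightarrow> S \<subseteq> A \<and> (\<forall>w. (\<forall>i\<in>S. w i \<in> F) \<longrightarrow> (\<exists>v\<in>V. \<forall>i\<in>S. v i = w i))"

definition information_set :: "'i set \<Rightarrow> bool" where
  "information_set I \<longleftrightarrow> interpolates I \<and> (\<forall>u\<in>V. \<forall>v\<in>V. (\<forall>i\<in>I. u i = v i) \<longrightarrow> u = v)"

lemma interpolatesD:
  "interpolates S \<Longrightarrow> (\<And>i. i \<in> S \<Longrightarrow> w i \<in> F) \<Longrightarrow> \<exists>v\<in>V. \<forall>i\<in>S. v i = w i"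
  unfolding interpolates_def by blast

lemma interpolates_empty: "interpolates {}"
  using zero_word by (auto simp: interpolates_def)

text \<open>Since d vanishes on I, adding a multiple of it corrects the value at j without
  disturbing I; the factor is (w j - x j) / d j.\<close>

lemma interpolates_insert:
  assumes I: "interpolates I" and d: "d \<in> V" and dI: "\<And>i. i \<in> I \<Longrightarrow> d i = \<zero>"
    and j: "j \<in> A" and dj: "d j \<noteq> \<zero>"
  shows "interpolates (insert j I)"
  unfolding interpolates_def
proof (intro conjI allI impI)
  show "insert j I \<subseteq> A" using I j by (auto simp: interpolates_def)
  fix w assume w: "\<forall>i\<in>insert j I. w i \<in> F"
  then obtain x where x: "x \<in> V" "\<forall>i\<in>I. x i = w i"
    using I unfolding interpolates_def by auto
  define c where "c = (w j \<oplus> \<ominus> x j) \<otimes> inv (d j)"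
  have F: "w j \<in> F" "x j \<in> F" "d j \<in> F" using w x d j word_in_F by auto
  then have c: "c \<in> F" using dj by (simp add: c_def)
  have C: "w j \<in> carrier R" "x j \<in> carrier R" "d j \<in> carrier R" "inv (d j) \<in> carrier R"
    using F F_sub dj by auto
  have "c \<otimes> d j = (w j \<oplus> \<ominus> x j) \<otimes> (inv (d j) \<otimes> d j)"
    using C by (simp add: c_def m_assoc)
  also have "inv (d j) \<otimes> d j = \<one>" using C dj by (simp add: field_Units)
  finally have "x j \<oplus> c \<otimes> d j = w j" using C a_lcomm[of "x j" "w j" "\<ominus> x j"] by (simp add: r_neg)
  then have "(\<lambda>i\<in>A. x i \<oplus> c \<otimes> d i) j = w j" using j by simp
  moreover have "(\<lambda>i\<in>A. x i \<oplus> c \<otimes> d i) i = w i" if "i \<in> I" for i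
  proof -
    have "i \<in> A" using that I by (auto simp: interpolates_def)
    moreover from this have "x i \<in> carrier R" using x word_closed by blast
    ultimately show ?thesis using x that dI c F_sub by simp
  qed
  ultimately show "\<exists>v\<in>V. \<forall>i\<in>insert j I. v i = w i"
    using combine[OF x(1) d c] by blast
qed

text \<open>A maximal interpolating superset works: if two words agreed on it but differed at j,
  their difference would allow j to be inserted.\<close>

lemma information_set_extend:
  assumes S: "interpolates S"
  obtains I where "S \<subseteq> I" "information_set I"
proof -
  let ?\<I> = "{I. interpolates I}"
  have "?\<I> \<subseteq> Pow A" by (auto simp: interpolates_def)
  then have "finite ?\<I>" using finite_A by (auto intro: finite_subset)
  then obtain I where I: "interpolates I" "S \<subseteq> I"
    and max: "\<And>J. interpolates J \<Longrightarrow> I \<subseteq> J \<Longrightarrow> I = J"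
    using finite_has_maximal2[of ?\<I> S] S by auto
  have "u = v" if u: "u \<in> V" and v: "v \<in> V" and eq: "\<forall>i\<in>I. u i = v i" for u v
  proof (rule ccontr)
    assume "u \<noteq> v"
    then obtain j where j: "j \<in> A" "u j \<noteq> v j" using word_eqI[OF u v] by blast
    let ?d = "\<lambda>i\<in>A. u i \<oplus> (\<ominus> \<one>) \<otimes> v i"
    have d: "?d \<in> V" using combine[OF u v, of "\<ominus> \<one>"] by simp
    have di: "?d i = \<zero> \<longleftrightarrow> u i = v i" if "i \<in> A" for i
    proof -
      have c: "u i \<in> carrier R" "v i \<in> carrier R" using that u v word_closed by auto
      then have "?d i = u i \<ominus> v i" using that by (simp add: l_minus minus_eq)
      then show ?thesis using c by simp
    qed
    have "interpolates (insert j I)"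
    proof (rule interpolates_insert[OF I(1) d])
      show "?d i = \<zero>" if "i \<in> I" for i
        using that eq di I(1) unfolding interpolates_def by blast
    qed (use j di in auto)
    then have "j \<in> I" using max[of "insert j I"] by blast
    then show False using eq j by blast
  qed
  then show thesis using that[OF I(2)] I(1) unfolding information_set_def by blast
qed

text \<open>Restriction to I is a bijection from V onto all F-valued functions on I, so
  \<open>card I\<close> plays the part of the dimension.\<close>

lemma card_code:
  assumes I: "information_set I"
  shows "card V = card F ^ card I"
proof -
  have IA: "I \<subseteq> A" and int: "interpolates I" using I by (auto simp: information_set_def interpolates_def)
  have "bij_betw (\<lambda>v. restrict v I) V (I \<rightarrow>\<^sub>E F)"
    unfolding bij_betw_def
  proof
    show "inj_on (\<lambda>v. restrict v I) V"
    proof (rule inj_onI)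
      fix u v assume uv: "u \<in> V" "v \<in> V" "restrict u I = restrict v I"
      then have "\<forall>i\<in>I. u i = v i" by (metis restrict_apply')
      then show "u = v" using I uv unfolding information_set_def by blast
    qed
    show "(\<lambda>v. restrict v I) ` V = I \<rightarrow>\<^sub>E F"
    proof
      show "(\<lambda>v. restrict v I) ` V \<subseteq> I \<rightarrow>\<^sub>E F" using IA word_in_F by auto
      show "I \<rightarrow>\<^sub>E F \<subseteq> (\<lambda>v. restrict v I) ` V"
      proof
        fix w assume w: "w \<in> I \<rightarrow>\<^sub>E F"
        then have "\<forall>i\<in>I. w i \<in> F" by auto
        then obtain v where v: "v \<in> V" "\<forall>i\<in>I. v i = w i"
          using int unfolding interpolates_def by blast
        then have "restrict v I = w" using w by (intro ext) (auto simp: restrict_def PiE_def extensional_def)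
        then show "w \<in> (\<lambda>v. restrict v I) ` V" using v by blast
      qed
    qed
  qed
  then have "card V = card (I \<rightarrow>\<^sub>E F)" by (rule bij_betw_same_card)
  then show ?thesis using finite_subset[OF IA finite_A] by (simp add: card_funcsetE)
qed

section \<open>The Euclidean dual code and its size\<close>

definition dual :: "('i \<Rightarrow> 'a) set" where
  "dual = {y \<in> A \<rightarrow>\<^sub>E F. \<forall>v\<in>V. (\<Oplus>i\<in>A. v i \<otimes> y i) = \<zero>}"

lemma dual_in_F: "y \<in> dual \<Longrightarrow> i \<in> A \<Longrightarrow> y i \<in> F"
  by (auto simp: dual_def)

lemma dual_closed: "y \<in> dual \<Longrightarrow> i \<in> A \<Longrightarrow> y i \<in> carrier R"
  using dual_in_F F_sub by auto

lemma linear_code_dual: "linear_code R F A dual"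
proof (intro linear_code.intro linear_code_axioms.intro)
  show "field R" by (rule field_axioms)
  show "subfield F R" by (rule F)
  show "finite A" by (rule finite_A)
  show "dual \<subseteq> A \<rightarrow>\<^sub>E F" by (auto simp: dual_def)
  have "(\<Oplus>i\<in>A. v i \<otimes> (\<lambda>i\<in>A. \<zero>) i) = \<zero>" if "v \<in> V" for v
    using that word_closed by (intro add.finprod_one_eqI) auto
  then show "(\<lambda>i\<in>A. \<zero>) \<in> dual" by (auto simp: dual_def)
  fix y z c assume y: "y \<in> dual" and z: "z \<in> dual" and c: "c \<in> F"
  have "(\<Oplus>i\<in>A. v i \<otimes> (\<lambda>i\<in>A. y i \<oplus> c \<otimes> z i) i) = \<zero>" if v: "v \<in> V" for v
  proof -
    have cl: "c \<in> carrier R" "\<And>i. i \<in> A \<Longrightarrow> v i \<in> carrier R" "\<And>i. i \<in> A \<Longrightarrow> y i \<in> carrier R"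
      "\<And>i. i \<in> A \<Longrightarrow> z i \<in> carrier R"
      using y z v c word_closed dual_closed F_sub by auto
    have "(\<Oplus>i\<in>A. v i \<otimes> (\<lambda>i\<in>A. y i \<oplus> c \<otimes> z i) i)
        = (\<Oplus>i\<in>A. v i \<otimes> y i \<oplus> c \<otimes> (v i \<otimes> z i))"
      using cl by (intro finsum_cong') (auto simp: r_distr m_lcomm)
    also have "\<dots> = (\<Oplus>i\<in>A. v i \<otimes> y i) \<oplus> (\<Oplus>i\<in>A. c \<otimes> (v i \<otimes> z i))"
      using cl by (intro finsum_addf) auto
    also have "(\<Oplus>i\<in>A. c \<otimes> (v i \<otimes> z i)) = c \<otimes> (\<Oplus>i\<in>A. v i \<otimes> z i)"
      using cl finite_A by (intro finsum_rdistr[symmetric]) auto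
    finally show ?thesis using y z v cl by (simp add: dual_def)
  qed
  then show "(\<lambda>i\<in>A. y i \<oplus> c \<otimes> z i) \<in> dual"
    using y z c dual_in_F by (auto simp: dual_def PiE_mem[of _ A "\<lambda>_. F"])
qed

text \<open>Pairing y with a code word that is the unit vector at j on S isolates y j. So if all
  t-element sets interpolate, the dual has minimum distance above t.\<close>

lemma dual_supported_zero:
  assumes S: "interpolates S" and y: "y \<in> dual"
    and supp: "\<And>i. i \<in> A \<Longrightarrow> i \<notin> S \<Longrightarrow> y i = \<zero>" and j: "j \<in> A"
  shows "y j = \<zero>"
proof (cases "j \<in> S")
  case True
  define w where "w i = (if i = j then \<one> else \<zero>)" for i
  have "\<forall>i\<in>S. w i \<in> F" by (simp add: w_def)
  then obtain v where v: "v \<in> V" "\<forall>i\<in>S. v i = w i"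
    using S unfolding interpolates_def by blast
  have "(\<Oplus>i\<in>A. v i \<otimes> y i) = (\<Oplus>i\<in>A. if j = i then y i else \<zero>)"
  proof (rule finsum_cong')
    fix i assume i: "i \<in> A"
    then show "v i \<otimes> y i = (if j = i then y i else \<zero>)"
      using v y supp word_closed dual_closed True by (cases "i \<in> S") (auto simp: w_def)
  qed (use y dual_closed in auto)
  also have "\<dots> = y j" using j finite_A y dual_closed by (intro add.finprod_singleton) auto
  finally show ?thesis using y v by (simp add: dual_def)
qed (use j supp in auto)

lemma linear_combination_in_code:
  assumes "finite J" "\<And>i. i \<in> J \<Longrightarrow> g i \<in> V" "\<And>i. i \<in> J \<Longrightarrow> c i \<in> F"
  shows "(\<lambda>j\<in>A. \<Oplus>i\<in>J. c i \<otimes> g i j) \<in> V"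
  using assms
proof (induction J rule: finite_induct)
  case empty
  have "(\<lambda>j\<in>A. \<Oplus>i\<in>{}. c i \<otimes> g i j) = (\<lambda>j\<in>A. \<zero>)" by (rule restrict_ext) simp
  then show ?case by (simp only: zero_word)
next
  case (insert x J)
  let ?u = "\<lambda>j\<in>A. \<Oplus>i\<in>J. c i \<otimes> g i j"
  have "(\<lambda>j\<in>A. ?u j \<oplus> c x \<otimes> g x j) \<in> V" using insert by (intro combine) auto
  moreover have "(\<lambda>j\<in>A. ?u j \<oplus> c x \<otimes> g x j) = (\<lambda>j\<in>A. \<Oplus>i\<in>insert x J. c i \<otimes> g i j)"
  proof (rule restrict_ext)
    fix j assume j: "j \<in> A"
    have "(\<lambda>i. c i \<otimes> g i j) \<in> J \<rightarrow> carrier R" "c x \<otimes> g x j \<in> carrier R"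
      using insert.prems j word_closed F_sub by auto
    then show "?u j \<oplus> c x \<otimes> g x j = (\<Oplus>i\<in>insert x J. c i \<otimes> g i j)"
      using insert.hyps j by (simp add: a_comm)
  qed
  ultimately show ?case by (simp only:)
qed

text \<open>With rows g of a generator matrix that is systematic on I, orthogonality to row g k says
  that y k is minus the sum of g k j y j over J = A - I. So the entries on J are free and determine
  the others.\<close>

lemma card_dual:
  assumes I: "information_set I"
  shows "card dual = card F ^ (card A - card I)"
proof -
  have IA: "I \<subseteq> A" and int: "interpolates I" using I by (auto simp: information_set_def interpolates_def)
  have finI: "finite I" using finite_subset[OF IA finite_A] .
  define J where "J = A - I"
  have finJ: "finite J" and JA: "J \<subseteq> A" using finite_A by (auto simp: J_def)
  have A_split: "(\<Oplus>i\<in>A. f i) = (\<Oplus>i\<in>I. f i) \<oplus> (\<Oplus>i\<in>J. f i)" if "f \<in> A \<rightarrow> carrier R" for f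
  proof -
    have "A = I \<union> J" "I \<inter> J = {}" using IA by (auto simp: J_def)
    then show ?thesis using that finI finJ by (auto intro!: finsum_Un_disjoint)
  qed
  \<comment> \<open>The systematic rows: g k is a code word that restricts to the unit vector at k
    on I.\<close>
  have "\<exists>v\<in>V. \<forall>i\<in>I. v i = (if i = k then \<one> else \<zero>)" for k
    using int unfolding interpolates_def by simp
  then obtain g where g: "\<And>k. g k \<in> V" "\<And>k i. i \<in> I \<Longrightarrow> g k i = (if i = k then \<one> else \<zero>)"
    by metis
  have gc: "g k i \<in> carrier R" "g k i \<in> F" if "i \<in> A" for k i
    using g that word_closed word_in_F by auto
  have pick: "(\<Oplus>i\<in>I. g k i \<otimes> f i) = f k" if k: "k \<in> I" and f: "f \<in> I \<rightarrow> carrier R" for f k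
  proof -
    have fc: "f i \<in> carrier R" if "i \<in> I" for i using f that by auto
    have "(\<Oplus>i\<in>I. g k i \<otimes> f i) = (\<Oplus>i\<in>I. if k = i then f i else \<zero>)"
      using fc g by (intro finsum_cong') auto
    then show ?thesis using k f finI by (simp add: add.finprod_singleton)
  qed
  have pick': "(\<Oplus>i\<in>I. f i \<otimes> g i k) = f k" if k: "k \<in> I" and f: "f \<in> I \<rightarrow> carrier R" for f k
  proof -
    have fc: "f i \<in> carrier R" if "i \<in> I" for i using f that by auto
    have "(\<Oplus>i\<in>I. f i \<otimes> g i k) = (\<Oplus>i\<in>I. if k = i then f i else \<zero>)"
      using fc g k by (intro finsum_cong') auto
    then show ?thesis using k f finI by (simp add: add.finprod_singleton)
  qed
  \<comment> \<open>A code word is the combination of the rows with its own entries on I as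
    coefficients, because both agree on I.\<close>
  have expand: "v j = (\<Oplus>i\<in>I. v i \<otimes> g i j)" if v: "v \<in> V" and j: "j \<in> A" for v j
  proof -
    let ?u = "\<lambda>j\<in>A. \<Oplus>i\<in>I. v i \<otimes> g i j"
    have u: "?u \<in> V" using v IA word_in_F g finI by (intro linear_combination_in_code) auto
    have vI: "v \<in> I \<rightarrow> carrier R" using v IA word_closed by auto
    have "v i = ?u i" if "i \<in> I" for i using pick'[OF that vI] that IA by auto
    then have "v = ?u" using I u v unfolding information_set_def by blast
    from fun_cong[OF this, of j] show ?thesis using j by simp
  qed
  have determined: "y k = \<ominus> (\<Oplus>j\<in>J. g k j \<otimes> y j)" if y: "y \<in> dual" and k: "k \<in> I" for y k
  proof -
    have cl: "(\<lambda>i. g k i \<otimes> y i) \<in> A \<rightarrow> carrier R" using gc y dual_closed by auto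
    have "\<zero> = (\<Oplus>i\<in>A. g k i \<otimes> y i)" using y g by (simp add: dual_def)
    also have "\<dots> = (\<Oplus>i\<in>I. g k i \<otimes> y i) \<oplus> (\<Oplus>j\<in>J. g k j \<otimes> y j)" by (rule A_split[OF cl])
    also have "(\<Oplus>i\<in>I. g k i \<otimes> y i) = y k" using k y IA dual_closed by (intro pick) auto
    finally have "y k \<oplus> (\<Oplus>j\<in>J. g k j \<otimes> y j) = \<zero>" by simp
    moreover have "y k \<in> carrier R" "(\<Oplus>j\<in>J. g k j \<otimes> y j) \<in> carrier R"
      using k y IA JA dual_closed gc by (auto intro!: finsum_closed)
    ultimately show ?thesis by (metis minus_equality)
  qed
  have "bij_betw (\<lambda>y. restrict y J) dual (J \<rightarrow>\<^sub>E F)"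
    unfolding bij_betw_def
  proof
    show "inj_on (\<lambda>y. restrict y J) dual"
    proof (rule inj_onI)
      fix y z assume yz: "y \<in> dual" "z \<in> dual" "restrict y J = restrict z J"
      have eqJ: "y j = z j" if "j \<in> J" for j using yz(3) that by (metis restrict_apply')
      have "y k = z k" if k: "k \<in> I" for k
      proof -
        have "(\<Oplus>j\<in>J. g k j \<otimes> y j) = (\<Oplus>j\<in>J. g k j \<otimes> z j)"
          using eqJ JA yz(2) gc dual_closed by (intro finsum_cong') auto
        then show ?thesis using determined yz k by metis
      qed
      then have "y i = z i" if "i \<in> A" for i using eqJ that by (auto simp: J_def)
      then show "y = z" using yz(1,2) by (auto simp: dual_def intro: PiE_ext)
    qed
    show "(\<lambda>y. restrict y J) ` dual = J \<rightarrow>\<^sub>E F"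
    proof
      show "(\<lambda>y. restrict y J) ` dual \<subseteq> J \<rightarrow>\<^sub>E F" using JA dual_in_F by auto
      show "J \<rightarrow>\<^sub>E F \<subseteq> (\<lambda>y. restrict y J) ` dual"
      proof
        fix w assume w: "w \<in> J \<rightarrow>\<^sub>E F"
        have wF: "w j \<in> F" "w j \<in> carrier R" if "j \<in> J" for j using w that F_sub by auto
        define s where "s i = (\<Oplus>j\<in>J. g i j \<otimes> w j)" for i
        have sF: "s i \<in> F" for i unfolding s_def using wF JA gc by (intro F_finsum) auto
        have sc: "s i \<in> carrier R" for i using sF F_sub by auto
        define y where "y = (\<lambda>i\<in>A. if i \<in> I then \<ominus> s i else w i)"
        have "(\<Oplus>i\<in>A. v i \<otimes> y i) = \<zero>" if v: "v \<in> V" for v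
        proof -
          have vc: "v i \<in> carrier R" if "i \<in> A" for i using v that word_closed by auto
          have vI: "v i \<in> carrier R" if "i \<in> I" for i using vc that IA by auto
          have gJ: "g i j \<in> carrier R" if "j \<in> J" for i j using gc that JA by auto
          have "(\<Oplus>i\<in>A. v i \<otimes> y i) = (\<Oplus>i\<in>I. v i \<otimes> y i) \<oplus> (\<Oplus>i\<in>J. v i \<otimes> y i)"
            using vc wF sc by (intro A_split) (auto simp: y_def J_def)
          also have "(\<Oplus>i\<in>I. v i \<otimes> y i) = (\<Oplus>i\<in>I. (\<ominus> \<one>) \<otimes> (v i \<otimes> s i))"
          proof (rule finsum_cong')
            fix i assume i: "i \<in> I"
            then have "v i \<otimes> y i = v i \<otimes> (\<ominus> s i)" using IA by (auto simp: y_def)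
            then show "v i \<otimes> y i = (\<ominus> \<one>) \<otimes> (v i \<otimes> s i)"
              using vI[OF i] sc[of i] by (simp add: r_minus l_minus)
          qed (use vI sc in auto)
          also have "\<dots> = (\<ominus> \<one>) \<otimes> (\<Oplus>i\<in>I. v i \<otimes> s i)"
            using vI sc finI by (intro finsum_rdistr[symmetric]) auto
          also have "\<dots> = \<ominus> (\<Oplus>i\<in>I. v i \<otimes> s i)"
          proof -
            have "(\<Oplus>i\<in>I. v i \<otimes> s i) \<in> carrier R" using vI sc by (intro finsum_closed) auto
            then show ?thesis by (simp add: l_minus)
          qed
          also have "(\<Oplus>i\<in>I. v i \<otimes> s i) = (\<Oplus>i\<in>I. \<Oplus>j\<in>J. v i \<otimes> (g i j \<otimes> w j))"
            using vI gJ wF finJ unfolding s_def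
            by (intro finsum_cong' finsum_rdistr) (auto intro!: finsum_closed)
          also have "\<dots> = (\<Oplus>j\<in>J. \<Oplus>i\<in>I. v i \<otimes> (g i j \<otimes> w j))"
            using vI gJ wF finI finJ by (intro finsum_finsum_swap) auto
          also have "(\<Oplus>i\<in>J. v i \<otimes> y i) = (\<Oplus>j\<in>J. \<Oplus>i\<in>I. v i \<otimes> (g i j \<otimes> w j))"
          proof (rule finsum_cong')
            fix j assume j: "j \<in> J"
            then have jA: "j \<in> A" using JA by auto
            have "v j \<otimes> y j = (\<Oplus>i\<in>I. v i \<otimes> g i j) \<otimes> w j"
              using expand[OF v jA] j by (simp add: y_def J_def)
            also have "\<dots> = (\<Oplus>i\<in>I. (v i \<otimes> g i j) \<otimes> w j)"
              using vI gJ wF finI j by (intro finsum_ldistr) auto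
            also have "\<dots> = (\<Oplus>i\<in>I. v i \<otimes> (g i j \<otimes> w j))"
              using vI gJ wF j by (intro finsum_cong') (auto simp: m_assoc)
            finally show "v j \<otimes> y j = (\<Oplus>i\<in>I. v i \<otimes> (g i j \<otimes> w j))" .
          qed (use vI gJ wF in \<open>auto intro!: finsum_closed\<close>)
          finally show ?thesis
            using vI gJ wF by (simp add: l_neg finsum_closed Pi_def)
        qed
        moreover have "y \<in> A \<rightarrow>\<^sub>E F" using sF wF by (auto simp: y_def J_def)
        ultimately have "y \<in> dual" by (simp add: dual_def)
        moreover have "restrict y J = w"
          using w by (intro ext) (auto simp: y_def J_def restrict_def PiE_def extensional_def)
        ultimately show "w \<in> (\<lambda>y. restrict y J) ` dual" by blast
      qed
    qed
  qed
  then have "card dual = card (J \<rightarrow>\<^sub>E F)" by (rule bij_betw_same_card)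
  also have "\<dots> = card F ^ card J" using finJ by (simp add: card_funcsetE)
  also have "card J = card A - card I" unfolding J_def using finI IA by (rule card_Diff_subset)
  finally show ?thesis .
qed

end

section \<open>Quantum codes from self-orthogonal codes\<close>

lemma qudit_inject:
  assumes "j < q ^ n" "k < q ^ n" "\<And>i. i < n \<Longrightarrow> qudit q j i = qudit q k i"
  shows "j = k"
  using assms
proof (induction n arbitrary: j k)
  case (Suc n)
  have "j div q < q ^ n" "k div q < q ^ n"
    using Suc.prems(1,2) by (auto simp: less_mult_imp_div_less mult.commute)
  moreover have "qudit q (j div q) i = qudit q (k div q) i" if "i < n" for i
    using Suc.prems(3)[of "Suc i"] that by (simp add: qudit_def div_mult2_eq)
  ultimately have "j div q = k div q" using Suc.IH by blast
  moreover have "j mod q = k mod q" using Suc.prems(3)[of 0] by (simp add: qudit_def)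
  ultimately show ?case by (metis div_mult_mod_eq)
qed simp

lemma qudit_lt: "q > 0 \<Longrightarrow> qudit q j i < q"
  by (simp add: qudit_def)

text \<open>Here e is any labelling of the alphabet by digits. Digits determine an index below q^n,
  and counting turns injectivity into bijectivity.\<close>

lemma bij_betw_qudit_words:
  assumes e: "bij_betw e {..<q} F" and q: "q > 0"
  shows "bij_betw (\<lambda>j. \<lambda>i\<in>{..<n}. e (qudit q j i)) {..<q ^ n} ({..<n} \<rightarrow>\<^sub>E F)"
proof -
  let ?\<phi> = "\<lambda>j. \<lambda>i\<in>{..<n}. e (qudit q j i)"
  have inj: "inj_on ?\<phi> {..<q ^ n}"
  proof (rule inj_onI)
    fix j k assume jk: "j \<in> {..<q ^ n}" "k \<in> {..<q ^ n}" "?\<phi> j = ?\<phi> k"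
    have "qudit q j i = qudit q k i" if "i < n" for i
    proof -
      have "e (qudit q j i) = e (qudit q k i)" using fun_cong[OF jk(3), of i] that by simp
      then show ?thesis using e qudit_lt[OF q] by (auto simp: bij_betw_def inj_on_def)
    qed
    then show "j = k" using qudit_inject jk by auto
  qed
  have F: "finite F" "card F = q" using e bij_betw_finite bij_betw_same_card by fastforce+
  have sub: "?\<phi> ` {..<q ^ n} \<subseteq> {..<n} \<rightarrow>\<^sub>E F"
    using e qudit_lt[OF q] by (auto simp: bij_betw_def PiE_def extensional_def)
  have "card (?\<phi> ` {..<q ^ n}) = card ({..<n} \<rightarrow>\<^sub>E F)"
    using card_image[OF inj] F by (simp add: card_funcsetE)
  then have "?\<phi> ` {..<q ^ n} = {..<n} \<rightarrow>\<^sub>E F"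
    using sub F by (intro card_subset_eq finite_PiE) auto
  then show ?thesis using inj by (simp add: bij_betw_def)
qed

context linear_code
begin

section \<open>Cosets of a linear code\<close>

definition coset :: "('i \<Rightarrow> 'a) \<Rightarrow> ('i \<Rightarrow> 'a) set" where
  "coset x = (\<lambda>c. \<lambda>i\<in>A. x i \<oplus> c i) ` V"

text \<open>The left side translates the entry x + b of a word in the coset of x by y - x - c; the
  right side shows that the result lies in the coset of y, as b - c is again an entry of a code
  word.\<close>

lemma translate_sum:
  assumes x: "x \<in> carrier R" and y: "y \<in> carrier R" and c: "c \<in> carrier R" and b: "b \<in> carrier R"
  shows "y \<ominus> x \<ominus> c \<oplus> (x \<oplus> b) = y \<oplus> (b \<ominus> c)"
proof -
  have "y \<ominus> x \<ominus> c \<oplus> (x \<oplus> b) = y \<oplus> (\<ominus> c \<oplus> (\<ominus> x \<oplus> (x \<oplus> b)))"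
    using assms by (simp add: minus_eq a_ac)
  also have "\<ominus> x \<oplus> (x \<oplus> b) = b" using x b by (simp add: a_assoc[symmetric] l_neg)
  finally show ?thesis using assms by (simp add: minus_eq a_comm)
qed

lemma word_add: "u \<in> V \<Longrightarrow> v \<in> V \<Longrightarrow> (\<lambda>i\<in>A. u i \<oplus> v i) \<in> V"
proof -
  assume uv: "u \<in> V" "v \<in> V"
  have "(\<lambda>i\<in>A. u i \<oplus> \<one> \<otimes> v i) = (\<lambda>i\<in>A. u i \<oplus> v i)"
    using uv word_closed by (intro restrict_ext) simp
  then show ?thesis using combine[OF uv, of \<one>] by simp
qed

lemma word_diff: "u \<in> V \<Longrightarrow> v \<in> V \<Longrightarrow> (\<lambda>i\<in>A. u i \<ominus> v i) \<in> V"
proof -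
  assume uv: "u \<in> V" "v \<in> V"
  have "(\<lambda>i\<in>A. u i \<oplus> (\<ominus> \<one>) \<otimes> v i) = (\<lambda>i\<in>A. u i \<ominus> v i)"
    using uv word_closed by (intro restrict_ext) (simp add: l_minus minus_eq)
  then show ?thesis using combine[OF uv, of "\<ominus> \<one>"] by simp
qed

lemma inj_on_translate:
  assumes J: "J \<subseteq> A \<rightarrow>\<^sub>E carrier R" and d: "\<And>i. i \<in> A \<Longrightarrow> d i \<in> carrier R"
  shows "inj_on (\<lambda>u. \<lambda>i\<in>A. d i \<oplus> u i) J"
proof (rule inj_onI)
  fix u v assume uv: "u \<in> J" "v \<in> J" and eq: "(\<lambda>i\<in>A. d i \<oplus> u i) = (\<lambda>i\<in>A. d i \<oplus> v i)"
  have "u i = v i" if i: "i \<in> A" for i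
  proof -
    have "u i \<in> carrier R" "v i \<in> carrier R" using uv J i by auto
    moreover have "d i \<oplus> u i = d i \<oplus> v i" using fun_cong[OF eq, of i] i by simp
    ultimately show ?thesis using d[OF i] by simp
  qed
  moreover have "u \<in> A \<rightarrow>\<^sub>E carrier R" "v \<in> A \<rightarrow>\<^sub>E carrier R" using uv J by auto
  ultimately show "u = v" by (blast intro: PiE_ext)
qed

lemma V_words: "V \<subseteq> A \<rightarrow>\<^sub>E carrier R"
  using V_sub F_sub by (auto simp: PiE_def Pi_def)

lemma card_coset:
  assumes "\<And>i. i \<in> A \<Longrightarrow> x i \<in> carrier R"
  shows "card (coset x) = card V"
  unfolding coset_def by (rule card_image[OF inj_on_translate[OF V_words assms]])

lemma coset_eqI:
  assumes x: "\<And>i. i \<in> A \<Longrightarrow> x i \<in> carrier R" and z: "z \<in> coset x"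
  shows "coset z = coset x"
proof
  obtain c where c: "c \<in> V" and zc: "z = (\<lambda>i\<in>A. x i \<oplus> c i)" using z by (auto simp: coset_def)
  show "coset z \<subseteq> coset x"
  proof
    fix u assume "u \<in> coset z"
    then obtain b where b: "b \<in> V" and u: "u = (\<lambda>i\<in>A. z i \<oplus> b i)" by (auto simp: coset_def)
    have "u = (\<lambda>i\<in>A. x i \<oplus> (\<lambda>i\<in>A. c i \<oplus> b i) i)"
      unfolding u zc using x c b word_closed by (intro restrict_ext) (simp add: a_assoc)
    then show "u \<in> coset x" unfolding coset_def using word_add[OF c b] by (rule image_eqI)
  qed
  show "coset x \<subseteq> coset z"
  proof
    fix u assume "u \<in> coset x"
    then obtain b where b: "b \<in> V" and u: "u = (\<lambda>i\<in>A. x i \<oplus> b i)" by (auto simp: coset_def)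
    have "u = (\<lambda>i\<in>A. z i \<oplus> (\<lambda>i\<in>A. b i \<ominus> c i) i)"
      unfolding u zc
    proof (rule restrict_ext)
      fix i assume i: "i \<in> A"
      then have cl: "x i \<in> carrier R" "b i \<in> carrier R" "c i \<in> carrier R"
        using x b c word_closed by auto
      have "x i \<oplus> c i \<oplus> (b i \<ominus> c i) = x i \<oplus> (c i \<oplus> (b i \<oplus> \<ominus> c i))"
        using cl by (simp add: a_assoc minus_eq)
      also have "\<dots> = x i \<oplus> b i" using cl by (simp add: a_lcomm[of "c i"] r_neg)
      finally show "x i \<oplus> b i = (\<lambda>i\<in>A. x i \<oplus> c i) i \<oplus> (\<lambda>i\<in>A. b i \<ominus> c i) i"
        using i by simp
    qed
    then show "u \<in> coset z" unfolding coset_def using word_diff[OF b c] by (rule image_eqI)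
  qed
qed

end

text \<open>This is the CSS construction with both codes equal to C; the number |dual| / |C| of
  cosets is the dimension. Interpolation on S is used twice: it makes a dual word supported on S
  vanish, and it supplies a word of C that aligns two given cosets on S.\<close>

theorem qecc_of_self_orthogonal_code:
  fixes C :: "(nat \<Rightarrow> 'a) set" and R (structure)
  assumes code: "linear_code R F {..<n} C"
    and F: "finite F" "card F = q"
    and self_orth: "C \<subseteq> linear_code.dual R F {..<n} C"
    and info: "linear_code.information_set F {..<n} C I"
    and interp: "\<And>S. S \<subseteq> {..<n} \<Longrightarrow> card S < \<delta> \<Longrightarrow> linear_code.interpolates F {..<n} C S"
  shows "\<exists>Q. qecc q n (n - 2 * card I) \<delta> Q"
proof -
  interpret C: linear_code R F "{..<n}" C by (rule code)
  interpret D: linear_code R F "{..<n}" C.dual by (rule C.linear_code_dual)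
  have "{\<zero>, \<one>} \<subseteq> F" by simp
  then have "card {\<zero>, \<one>} \<le> q" using F card_mono by blast
  then have q: "q > 1" by simp
  obtain e where e: "bij_betw e {..<q} F"
    using ex_bij_betw_nat_finite[OF F(1)] F(2) by (auto simp: atLeast0LessThan)
  \<comment> \<open>\<open>\<phi>\<close> reads the word off a basis index, and its inverse
    \<open>\<psi>\<close> turns a word into an index.\<close>
  define \<phi> where "\<phi> = (\<lambda>j. \<lambda>i\<in>{..<n}. e (qudit q j i))"
  have \<phi>: "bij_betw \<phi> {..<q ^ n} ({..<n} \<rightarrow>\<^sub>E F)"
    unfolding \<phi>_def using bij_betw_qudit_words[OF e] q by simp
  define \<psi> where "\<psi> = inv_into {..<q ^ n} \<phi>"
  have \<psi>: "bij_betw \<psi> ({..<n} \<rightarrow>\<^sub>E F) {..<q ^ n}"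
    unfolding \<psi>_def by (rule bij_betw_inv_into[OF \<phi>])
  have \<phi>\<psi>: "\<phi> (\<psi> w) = w" if "w \<in> {..<n} \<rightarrow>\<^sub>E F" for w
    unfolding \<psi>_def using \<phi> that by (simp add: bij_betw_inv_into_right)
  have qudit_\<psi>: "e (qudit q (\<psi> w) i) = w i" if "w \<in> {..<n} \<rightarrow>\<^sub>E F" "i < n" for w i
    using fun_cong[OF \<phi>\<psi>[OF that(1)], of i] that(2) by (simp add: \<phi>_def)
  have qudit_eq: "qudit q (\<psi> u) i = qudit q (\<psi> v) i \<longleftrightarrow> u i = v i"
    if "u \<in> {..<n} \<rightarrow>\<^sub>E F" "v \<in> {..<n} \<rightarrow>\<^sub>E F" "i < n" for u v i
  proof -
    have "inj_on e {..<q}" using e by (rule bij_betw_imp_inj_on)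
    moreover have "qudit q (\<psi> u) i \<in> {..<q}" "qudit q (\<psi> v) i \<in> {..<q}" using q qudit_lt by auto
    ultimately have "e (qudit q (\<psi> u) i) = e (qudit q (\<psi> v) i)
        \<longleftrightarrow> qudit q (\<psi> u) i = qudit q (\<psi> v) i"
      by (rule inj_on_eq_iff)
    then show ?thesis using qudit_\<psi>[OF that(1,3)] qudit_\<psi>[OF that(2,3)] by simp
  qed
  have dualF: "C.dual \<subseteq> {..<n} \<rightarrow>\<^sub>E F" by (rule D.V_sub)
  have coset_dual: "C.coset x \<subseteq> C.dual" if "x \<in> C.dual" for x
    using D.word_add[OF that] self_orth by (auto simp: C.coset_def)
  have in_coset: "x \<in> C.coset x" if x: "x \<in> C.dual" for x
  proof -
    have "x = (\<lambda>i\<in>{..<n}. x i \<oplus> (\<lambda>i\<in>{..<n}. \<zero>) i)"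
    proof (rule D.word_eqI[OF x])
      show "(\<lambda>i\<in>{..<n}. x i \<oplus> (\<lambda>i\<in>{..<n}. \<zero>) i) \<in> C.dual"
        using D.word_add[OF x D.zero_word] .
    qed (use x C.dual_closed in auto)
    then show ?thesis unfolding C.coset_def using C.zero_word by (rule image_eqI)
  qed
  define Ks where "Ks = C.coset ` C.dual"
  have Ks_union: "\<Union>Ks = C.dual" using coset_dual in_coset by (auto simp: Ks_def)
  have Ks_disj: "K = K'" if K: "K \<in> Ks" "K' \<in> Ks" and z: "z \<in> K" "z \<in> K'" for K K' z
  proof -
    obtain x x' where x: "x \<in> C.dual" "K = C.coset x" and x': "x' \<in> C.dual" "K' = C.coset x'"
      using K unfolding Ks_def by blast
    have "C.coset z = K" using C.coset_eqI[of x z] C.dual_closed[OF x(1)] x(2) z(1) by simp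
    moreover have "C.coset z = K'"
      using C.coset_eqI[of x' z] C.dual_closed[OF x'(1)] x'(2) z(2) by simp
    ultimately show ?thesis by simp
  qed
  have Ks_card: "card K = card C" if K: "K \<in> Ks" for K
  proof -
    obtain x where x: "x \<in> C.dual" "K = C.coset x" using K unfolding Ks_def by blast
    then show ?thesis using C.card_coset[of x] C.dual_closed[OF x(1)] by simp
  qed
  have fin_dual: "finite C.dual"
    by (rule finite_subset[OF dualF]) (simp add: finite_PiE F)
  have finC: "finite C" using finite_subset[OF self_orth fin_dual] .
  have card_pos: "card C > 0" using finC C.zero_word by (auto simp: card_gt_0_iff)
  \<comment> \<open>Comparing |C| with |dual| gives |I| <= n - |I|, so the subtraction n - 2|I| is
    not truncated.\<close>
  have "q ^ card I \<le> q ^ (n - card I)"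
    using card_mono[OF fin_dual self_orth] C.card_code[OF info] C.card_dual[OF info] F by simp
  then have le: "card I \<le> n - card I" using q by simp
  have "card C.dual = card Ks * card C"
  proof -
    have "card C * card Ks = card (\<Union>Ks)"
    proof (rule card_partition)
      show "finite Ks" using fin_dual by (simp add: Ks_def)
      show "finite (\<Union>Ks)" using fin_dual by (simp add: Ks_union)
      show "K \<inter> K' = {}" if "K \<in> Ks" "K' \<in> Ks" "K \<noteq> K'" for K K'
        using Ks_disj[OF that(1,2)] that(3) by blast
    qed (rule Ks_card)
    then show ?thesis by (simp add: Ks_union mult.commute)
  qed
  then have "card Ks * q ^ card I = q ^ (n - 2 * card I) * q ^ card I"
    using C.card_code[OF info] C.card_dual[OF info] F le by (simp add: power_add[symmetric])
  then have card_Ks: "card Ks = q ^ (n - 2 * card I)" using q by simp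
  define \<P> where "\<P> = (\<lambda>K. \<psi> ` K) ` Ks"
  have Ks_sub: "K \<subseteq> {..<n} \<rightarrow>\<^sub>E F" if "K \<in> Ks" for K using that Ks_union dualF by blast
  have inj\<psi>: "inj_on \<psi> K" if "K \<in> Ks" for K
    using Ks_sub[OF that] \<psi> by (meson bij_betw_imp_inj_on inj_on_subset)
  have \<psi>_eq: "\<psi> u = \<psi> v \<longleftrightarrow> u = v" if "u \<in> {..<n} \<rightarrow>\<^sub>E F" "v \<in> {..<n} \<rightarrow>\<^sub>E F" for u v
    using that \<psi> by (auto simp: bij_betw_def inj_on_def)
  have "inj_on (\<lambda>K. \<psi> ` K) Ks"
    using \<psi> Ks_sub by (intro inj_on_image) (auto simp: bij_betw_def intro: inj_on_subset)
  then have card_P: "card \<P> = q ^ (n - 2 * card I)"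
    unfolding \<P>_def using card_Ks by (simp add: card_image)
  have P_union: "\<Union>\<P> = \<psi> ` C.dual" using Ks_union by (auto simp: \<P>_def)
  show ?thesis
  proof (rule qecc_of_blocks[of q n "card C" \<P>])
    show "block_code (q ^ n) (card C) \<P>"
    proof unfold_locales
      fix B B' assume B: "B \<in> \<P>" "B' \<in> \<P>" "B \<noteq> B'"
      then obtain K K' where K: "K \<in> Ks" "K' \<in> Ks" "B = \<psi> ` K" "B' = \<psi> ` K'"
        by (auto simp: \<P>_def)
      show "B \<inter> B' = {}"
      proof (rule equals0I)
        fix z assume "z \<in> B \<inter> B'"
        then obtain u v where uv: "u \<in> K" "v \<in> K'" "z = \<psi> u" "z = \<psi> v" using K by auto
        then have "u = v" using \<psi>_eq K Ks_sub by blast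
        then show False using Ks_disj[of K K' u] uv K B by blast
      qed
    next
      show "\<Union>\<P> \<subseteq> {..<q ^ n}" unfolding P_union
        using image_mono[OF dualF, of \<psi>] bij_betw_imp_surj_on[OF \<psi>] by simp
    next
      fix B assume "B \<in> \<P>"
      then show "card B = card C" using inj\<psi> Ks_card by (auto simp: \<P>_def card_image)
    qed (rule card_pos)
    show "card \<P> = q ^ (n - 2 * card I)" by (rule card_P)
    show "q > 0" using q by simp
  next
    fix S u v
    assume S: "S \<subseteq> {..<n}" "card S < \<delta>" and uv: "u \<in> \<Union>\<P>" "v \<in> \<Union>\<P>"
      and eq: "\<forall>i\<in>{..<n} - S. qudit q u i = qudit q v i"
    obtain x y where xy: "x \<in> C.dual" "y \<in> C.dual" "u = \<psi> x" "v = \<psi> y"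
      using uv unfolding P_union by auto
    have xyF: "x \<in> {..<n} \<rightarrow>\<^sub>E F" "y \<in> {..<n} \<rightarrow>\<^sub>E F" using xy dualF by auto
    let ?d = "\<lambda>i\<in>{..<n}. x i \<ominus> y i"
    have cl: "x i \<in> carrier R" "y i \<in> carrier R" if "i < n" for i
      using xy C.dual_closed that by auto
    \<comment> \<open>The difference of x and y is a dual word supported on S, hence zero.\<close>
    have "?d j = \<zero>" if "j \<in> {..<n}" for j
    proof (rule C.dual_supported_zero[OF interp[OF S] D.word_diff[OF xy(1,2)] _ that])
      fix i assume i: "i \<in> {..<n}" "i \<notin> S"
      then have "x i = y i" using eq qudit_eq[OF xyF] xy by auto
      then show "?d i = \<zero>" using i cl by simp
    qed
    then have "x i = y i" if "i < n" for i using that cl by simp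
    then have "x = y" using D.word_eqI[OF xy(1,2)] by auto
    then show "u = v" using xy by simp
  next
    fix S B B'
    assume S: "S \<subseteq> {..<n}" "card S < \<delta>" and B: "B \<in> \<P>" "B' \<in> \<P>"
    obtain x y where xy: "x \<in> C.dual" "y \<in> C.dual" and BB: "B = \<psi> ` C.coset x" "B' = \<psi> ` C.coset y"
      using B by (auto simp: \<P>_def Ks_def)
    have cl: "x i \<in> carrier R" "y i \<in> carrier R" if "i < n" for i
      using xy C.dual_closed that by auto
    have clF: "x i \<in> F" "y i \<in> F" if "i < n" for i
      using xy C.dual_in_F that by auto
    \<comment> \<open>Choose c in C equal to y - x on S. Translation by y - x - c then carries the
      coset of x onto that of y and leaves every entry on S unchanged.\<close>
    have "\<forall>i\<in>S. y i \<ominus> x i \<in> F" using S clF by (auto simp: C.minus_eq)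
    then obtain c where c: "c \<in> C" "\<forall>i\<in>S. c i = y i \<ominus> x i"
      using interp[OF S] unfolding C.interpolates_def by (elim conjE allE[of _ "\<lambda>i. y i \<ominus> x i"]) blast
    have cc: "c i \<in> carrier R" if "i < n" for i using c C.word_closed that by auto
    let ?d = "\<lambda>i. y i \<ominus> x i \<ominus> c i"
    let ?h = "\<lambda>u. \<lambda>i\<in>{..<n}. ?d i \<oplus> u i"
    have d: "?d i \<in> carrier R" if "i < n" for i using cl cc that by simp
    have Kx: "C.coset x \<in> Ks" and Ky: "C.coset y \<in> Ks" using xy by (auto simp: Ks_def)
    have into: "?h u \<in> C.coset y" if u: "u \<in> C.coset x" for u
    proof -
      obtain b where b: "b \<in> C" "u = (\<lambda>i\<in>{..<n}. x i \<oplus> b i)" using u by (auto simp: C.coset_def)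
      have "?h u = (\<lambda>i\<in>{..<n}. y i \<oplus> (\<lambda>i\<in>{..<n}. b i \<ominus> c i) i)"
        unfolding b(2)
      proof (rule restrict_ext)
        fix i assume i: "i \<in> {..<n}"
        then have "x i \<in> carrier R" "y i \<in> carrier R" "c i \<in> carrier R" "b i \<in> carrier R"
          using cl cc b C.word_closed by auto
        then have "?d i \<oplus> (x i \<oplus> b i) = y i \<oplus> (b i \<ominus> c i)" by (rule C.translate_sum)
        then show "?d i \<oplus> (\<lambda>i\<in>{..<n}. x i \<oplus> b i) i = y i \<oplus> (\<lambda>i\<in>{..<n}. b i \<ominus> c i) i"
          using i by simp
      qed
      then show ?thesis unfolding C.coset_def using C.word_diff[OF b(1) c(1)] by (rule image_eqI)
    qed
    have words: "C.coset x \<subseteq> {..<n} \<rightarrow>\<^sub>E carrier R"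
      using coset_dual[OF xy(1)] D.V_words by blast
    have inj_h: "inj_on ?h (C.coset x)"
      using d by (intro C.inj_on_translate[OF words]) auto
    have "card (?h ` C.coset x) = card (C.coset y)"
      using card_image[OF inj_h] Ks_card Kx Ky by simp
    moreover have "finite (C.coset y)" using finC by (simp add: C.coset_def)
    ultimately have "?h ` C.coset x = C.coset y"
      using into by (intro card_subset_eq) auto
    then have h: "bij_betw ?h (C.coset x) (C.coset y)" using inj_h by (simp add: bij_betw_def)
    have \<psi>x: "bij_betw \<psi> (C.coset x) B" and \<psi>y: "bij_betw \<psi> (C.coset y) B'"
      using inj\<psi> Kx Ky BB by (auto simp: bij_betw_def)
    \<comment> \<open>The same translation, transported from words to basis indices.\<close>
    let ?g = "\<psi> \<circ> ?h \<circ> inv_into (C.coset x) \<psi>"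
    have "bij_betw ?g B B'"
      by (intro bij_betw_trans[OF bij_betw_trans[OF bij_betw_inv_into[OF \<psi>x] h] \<psi>y, folded comp_assoc])
    moreover have "qudit q (?g u) i = qudit q u i" if u: "u \<in> B" and i: "i \<in> S" for u i
    proof -
      obtain w where w: "w \<in> C.coset x" "u = \<psi> w" using u BB by auto
      have "inv_into (C.coset x) \<psi> u = w" using w inj\<psi>[OF Kx] by simp
      then have g: "?g u = \<psi> (?h w)" by simp
      have wF: "w \<in> {..<n} \<rightarrow>\<^sub>E F" "?h w \<in> {..<n} \<rightarrow>\<^sub>E F"
        using w into Ks_sub Kx Ky by blast+
      have "i < n" using i S by auto
      moreover have "w i \<in> carrier R" using wF(1) \<open>i < n\<close> C.F_sub by auto
      ultimately have "?h w i = w i" using c i cl by simp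
      then show ?thesis using qudit_eq[OF wF(2,1) \<open>i < n\<close>] g w by simp
    qed
    ultimately show "\<exists>h. bij_betw h B B' \<and> (\<forall>u\<in>B. \<forall>i\<in>S. qudit q (h u) i = qudit q u i)"
      by blast
  qed
qed

section \<open>Finite fields\<close>

text \<open>Induction by Pascal's rule, in a general commutative ring because the expansion is also
  applied to polynomials.\<close>

lemma (in cring) binomial_expansion:
  assumes x: "x \<in> carrier R" and y: "y \<in> carrier R"
  shows "(x \<oplus> y) [^] n = (\<Oplus>k\<in>{..n}. [(n choose k)] \<cdot> (x [^] k \<otimes> y [^] (n - k)))"
proof (induction n)
  case 0
  then show ?case using x y by simp
next
  case (Suc n)
  define t where "t m k = [(m choose k)] \<cdot> (x [^] k \<otimes> y [^] (m - k))" for m k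
  have tc [simp]: "t m k \<in> carrier R" for m k unfolding t_def using x y by simp
  have t0: "t (Suc n) 0 = y \<otimes> t n 0"
    unfolding t_def using x y by (simp add: m_comm)
  have tS: "t (Suc n) (Suc k) = x \<otimes> t n k \<oplus> y \<otimes> t n (Suc k)" if k: "k \<le> n" for k
  proof -
    have 1: "x \<otimes> t n k = [(n choose k)] \<cdot> (x [^] Suc k \<otimes> y [^] (n - k))"
      unfolding t_def using x y by (simp add: add_pow_rdistr m_assoc[symmetric] m_comm[of x])
    have 2: "y \<otimes> t n (Suc k) = [(n choose Suc k)] \<cdot> (x [^] Suc k \<otimes> y [^] (n - k))"
    proof (cases "k < n")
      case True
      then have s: "n - k = Suc (n - Suc k)" by simp
      have "y \<otimes> (x [^] Suc k \<otimes> y [^] (n - Suc k)) = x [^] Suc k \<otimes> (y [^] (n - Suc k) \<otimes> y)"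
        using x y by (metis m_comm m_lcomm nat_pow_closed)
      then have "y \<otimes> (x [^] Suc k \<otimes> y [^] (n - Suc k)) = x [^] Suc k \<otimes> y [^] (n - k)"
        unfolding s nat_pow_Suc[of _ "n - Suc k"] .
      then show ?thesis
        unfolding t_def using x y by (simp only: add_pow_rdistr nat_pow_closed m_closed)
    next
      case False
      then have 0: "n choose Suc k = 0" by simp
      show ?thesis unfolding t_def 0 using x y by simp
    qed
    show ?thesis
      unfolding 1 2 using x y by (simp add: t_def add.nat_pow_mult del: nat_pow_Suc)
  qed
  have split: "(\<Oplus>k\<in>{..Suc n}. f k) = f 0 \<oplus> (\<Oplus>k\<in>{..n}. f (Suc k))"
    if "\<And>k. f k \<in> carrier R" for f
    using that by (subst finsum_Suc2) (auto simp: a_comm finsum_closed)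
  \<comment> \<open>The additional index Suc n contributes 0, since n choose Suc n is 0; both sums
    can then be split off at index 0 in the same way.\<close>
  have last: "(\<Oplus>k\<in>{..Suc n}. t n k) = (\<Oplus>k\<in>{..n}. t n k)"
    using x y by (subst finsum_Suc) (auto simp: t_def binomial_eq_0)
  have "(\<Oplus>k\<in>{..Suc n}. t (Suc n) k) = y \<otimes> t n 0 \<oplus> (\<Oplus>k\<in>{..n}. t (Suc n) (Suc k))"
    using split[of "t (Suc n)"] t0 by simp
  also have "(\<Oplus>k\<in>{..n}. t (Suc n) (Suc k)) = (\<Oplus>k\<in>{..n}. x \<otimes> t n k \<oplus> y \<otimes> t n (Suc k))"
    using x y by (intro finsum_cong') (auto simp: tS)
  also have "\<dots> = (\<Oplus>k\<in>{..n}. x \<otimes> t n k) \<oplus> (\<Oplus>k\<in>{..n}. y \<otimes> t n (Suc k))"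
    using x y by (intro finsum_addf) auto
  also have "(\<Oplus>k\<in>{..n}. x \<otimes> t n k) = x \<otimes> (\<Oplus>k\<in>{..n}. t n k)"
    using x by (intro finsum_rdistr[symmetric]) auto
  also have "(\<Oplus>k\<in>{..n}. y \<otimes> t n (Suc k)) = y \<otimes> (\<Oplus>k\<in>{..n}. t n (Suc k))"
    using y by (intro finsum_rdistr[symmetric]) auto
  also have "y \<otimes> t n 0 \<oplus> (x \<otimes> (\<Oplus>k\<in>{..n}. t n k) \<oplus> y \<otimes> (\<Oplus>k\<in>{..n}. t n (Suc k)))
      = x \<otimes> (\<Oplus>k\<in>{..n}. t n k) \<oplus> y \<otimes> (t n 0 \<oplus> (\<Oplus>k\<in>{..n}. t n (Suc k)))"
    using x y by (simp add: r_distr a_lcomm finsum_closed)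
  also have "t n 0 \<oplus> (\<Oplus>k\<in>{..n}. t n (Suc k)) = (\<Oplus>k\<in>{..n}. t n k)"
    using split[of "t n"] last by simp
  also have "x \<otimes> (\<Oplus>k\<in>{..n}. t n k) \<oplus> y \<otimes> (\<Oplus>k\<in>{..n}. t n k) = (x \<oplus> y) \<otimes> (\<Oplus>k\<in>{..n}. t n k)"
    using x y by (simp add: l_distr finsum_closed)
  also have "(\<Oplus>k\<in>{..n}. t n k) = (x \<oplus> y) [^] n" using Suc.IH by (simp add: t_def)
  finally show ?case using x y by (simp add: t_def m_comm)
qed

lemma (in ring_hom_cring) hom_nat_pow:
  "x \<in> carrier R \<Longrightarrow> h (x [^] (n::nat)) = h x [^]\<^bsub>S\<^esub> n"
  by (induction n) auto

text \<open>A commutative ring rather than a field, since Frobenius is used on polynomials as well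
  as on field elements.\<close>

locale char_p_cring = cring R for R (structure) +
  fixes p :: nat
  assumes p: "prime p" and char_p: "[p] \<cdot> \<one> = \<zero>"
begin

lemma p_mult_zero:
  assumes "x \<in> carrier R" "p dvd m"
  shows "[m] \<cdot> x = \<zero>"
proof -
  obtain k where m: "m = p * k" using assms(2) by blast
  have "[p] \<cdot> ([k] \<cdot> x) = ([p] \<cdot> \<one>) \<otimes> ([k] \<cdot> x)"
    using assms(1) by (simp add: add_pow_ldistr)
  then have "[p] \<cdot> ([k] \<cdot> x) = \<zero>" using assms(1) char_p by simp
  then show ?thesis using assms(1) m by (simp add: add.nat_pow_pow mult.commute)
qed

text \<open>The binomial coefficients p choose k with 0 < k < p are multiples of p, so only the two
  outer terms survive.\<close>

lemma frobenius_prime: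
  assumes x: "x \<in> carrier R" and y: "y \<in> carrier R"
  shows "(x \<oplus> y) [^] p = x [^] p \<oplus> y [^] p"
proof -
  define t where "t k = [(p choose k)] \<cdot> (x [^] k \<otimes> y [^] (p - k))" for k
  have tc: "t k \<in> carrier R" for k unfolding t_def using x y by simp
  \<comment> \<open>Writing p as n + 2 makes the inner indices exactly Suc k with k <= n.\<close>
  obtain n where "p = 2 + n" using le_Suc_ex[OF prime_ge_2_nat[OF p]] by blast
  then have n: "p = Suc (Suc n)" by simp
  have mid: "t (Suc k) = \<zero>" if "k \<le> n" for k
    unfolding t_def using x y p n that by (intro p_mult_zero dvd_choose_prime) auto
  have "(x \<oplus> y) [^] p = (\<Oplus>k\<in>{..Suc (Suc n)}. t k)"
    unfolding binomial_expansion[OF x y] t_def n ..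
  also have "\<dots> = t p \<oplus> (\<Oplus>k\<in>{..Suc n}. t k)"
    using tc unfolding n by (intro finsum_Suc) auto
  also have "(\<Oplus>k\<in>{..Suc n}. t k) = (\<Oplus>k\<in>{..n}. t (Suc k)) \<oplus> t 0"
    using tc by (intro finsum_Suc2) auto
  also have "(\<Oplus>k\<in>{..n}. t (Suc k)) = \<zero>"
    using mid by (intro add.finprod_one_eqI) auto
  finally show ?thesis using x y by (simp add: t_def)
qed

lemma frobenius_add:
  assumes "x \<in> carrier R" "y \<in> carrier R"
  shows "(x \<oplus> y) [^] (p ^ k) = x [^] (p ^ k) \<oplus> y [^] (p ^ k)"
proof (induction k)
  case (Suc k)
  have "z [^] (p ^ Suc k) = (z [^] (p ^ k)) [^] p" if "z \<in> carrier R" for z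
    using that by (simp add: nat_pow_pow mult.commute)
  then show ?case using assms Suc.IH by (simp add: frobenius_prime)
qed (use assms in simp)

lemma frobenius_zero: "\<zero> [^] (p ^ k) = \<zero>"
  using p by (simp add: nat_pow_zero prime_gt_0_nat)

text \<open>Additivity applied to (x - y) + y = x avoids evaluating the sign (-1)^(p^k) and a
  separate case p = 2.\<close>

lemma frobenius_minus:
  assumes x: "x \<in> carrier R" and y: "y \<in> carrier R"
  shows "(x \<ominus> y) [^] (p ^ k) = x [^] (p ^ k) \<ominus> y [^] (p ^ k)"
proof -
  have "(x \<ominus> y) \<oplus> y = x" using x y by (simp add: minus_eq a_assoc l_neg)
  then have "x [^] (p ^ k) = (x \<ominus> y) [^] (p ^ k) \<oplus> y [^] (p ^ k)"
    using frobenius_add[of "x \<ominus> y" y k] x y by simp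
  then show ?thesis using x y by (simp add: minus_eq a_assoc r_neg)
qed

lemma frobenius_finsum:
  assumes "\<And>i. i \<in> J \<Longrightarrow> f i \<in> carrier R"
  shows "(\<Oplus>i\<in>J. f i) [^] (p ^ k) = (\<Oplus>i\<in>J. f i [^] (p ^ k))"
  using assms
proof (induction J rule: infinite_finite_induct)
  case (insert x J)
  then have "f \<in> J \<rightarrow> carrier R" "f x \<in> carrier R" "(\<lambda>i. f i [^] (p ^ k)) \<in> J \<rightarrow> carrier R" by auto
  then show ?case using insert by (simp add: frobenius_add finsum_closed)
qed (auto simp: frobenius_zero)

end

text \<open>For Q a positive power of the characteristic of a field, these are the fixed points of
  an iterate of Frobenius, hence a subfield; it is GF(Q) once X^Q - X splits.\<close>

definition (in ring) fixed_by_power :: "nat \<Rightarrow> 'a set" where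
  "fixed_by_power Q = {x \<in> carrier R. x [^] Q = x}"

lemma (in field) subfield_fixed_by_power:
  assumes p: "prime p" and char: "[p] \<cdot> \<one> = \<zero>"
  shows "subfield (fixed_by_power (p ^ k)) R"
proof -
  interpret char_p_cring R p by unfold_locales (use p char in auto)
  let ?K = "fixed_by_power (p ^ k)"
  show ?thesis
  proof (rule subfieldI'[OF subringI])
    show "?K \<subseteq> carrier R" "\<one> \<in> ?K" by (auto simp: fixed_by_power_def)
    show "\<ominus> x \<in> ?K" if "x \<in> ?K" for x
      using that frobenius_minus[OF zero_closed, of x k] frobenius_zero
      by (auto simp: fixed_by_power_def minus_eq)
    show "x \<otimes> y \<in> ?K" if "x \<in> ?K" "y \<in> ?K" for x y
      using that by (auto simp: fixed_by_power_def nat_pow_distrib)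
    show "x \<oplus> y \<in> ?K" if "x \<in> ?K" "y \<in> ?K" for x y
      using that frobenius_add by (auto simp: fixed_by_power_def)
    show "inv x \<in> ?K" if "x \<in> ?K - {\<zero>}" for x
    proof -
      have x: "x \<in> carrier R" "x \<noteq> \<zero>" "x [^] (p ^ k) = x" using that by (auto simp: fixed_by_power_def)
      then have u: "x \<in> Units R" using field_Units by auto
      have "inv x [^] (p ^ k) \<otimes> x [^] (p ^ k) = (inv x \<otimes> x) [^] (p ^ k)"
        using u x(1) by (intro nat_pow_distrib[symmetric]) auto
      then have "inv x [^] (p ^ k) \<otimes> x = \<one>" using u x by simp
      then have "inv x = inv x [^] (p ^ k)"
        using u x(1) by (intro inv_char) (auto simp: m_comm)
      then show ?thesis using u by (auto simp: fixed_by_power_def)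
    qed
  qed
qed

text \<open>In the polynomial ring the Frobenius map gives \<open>X^Q - X = (X - a)^Q - (X - a)\<close> for every
  root \<open>a\<close>, which excludes multiple roots.\<close>
lemma (in field) card_fixed_by_power:
  assumes p: "prime p" and char: "[p] \<cdot> \<one> = \<zero>" and k: "k \<ge> 1"
    and split: "splitted (X [^]\<^bsub>poly_ring R\<^esub> (p ^ k) \<ominus>\<^bsub>poly_ring R\<^esub> X)"
  shows "card (fixed_by_power (p ^ k)) = p ^ k"
proof -
  let ?UP = "poly_ring R" and ?Q = "p ^ k"
  interpret UP: domain ?UP using univ_poly_is_domain[OF carrier_is_subring] .
  have Q: "?Q \<ge> 2" using p k prime_ge_2_nat[OF p] self_le_power[of p k] by simp
  have const_hom: "ring_hom_ring R ?UP poly_of_const"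
    using canonical_embedding_ring_hom[OF carrier_is_subring] by simp
  interpret const: ring_hom_cring R ?UP poly_of_const
    by (intro ring_hom_cring.intro ring_hom_cring_axioms.intro is_cring UP.is_cring
        ring_hom_ring.homh[OF const_hom])
  have const_add_pow: "poly_of_const ([m] \<cdot> \<one>) = [m] \<cdot>\<^bsub>?UP\<^esub> \<one>\<^bsub>?UP\<^esub>" for m :: nat
    by (induction m) (auto simp: add.nat_pow_Suc UP.add.nat_pow_Suc)
  \<comment> \<open>The constants carry the relation p 1 = 0 into the polynomial ring, so Frobenius
    is additive on polynomials.\<close>
  interpret UPc: char_p_cring ?UP p
    by unfold_locales (use p char const_add_pow[of p] in auto)
  have X: "X \<in> carrier ?UP" by (rule var_closed(1)[OF carrier_is_subring])
  define P where "P = X [^]\<^bsub>?UP\<^esub> ?Q \<ominus>\<^bsub>?UP\<^esub> X"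
  have P: "P \<in> carrier ?UP" using X by (simp add: P_def)
  have XQ: "X [^]\<^bsub>?UP\<^esub> ?Q = monom \<one> ?Q"
    using unitary_monom_eq_var_pow[OF carrier_is_subring] by simp
  have deg: "Polynomials.degree P = ?Q"
  proof -
    let ?M = "monom \<one> ?Q" and ?N = "\<ominus>\<^bsub>?UP\<^esub> X"
    have d1: "Polynomials.degree ?M = ?Q" by (simp add: monom_def)
    have d2: "Polynomials.degree ?N = 1"
      using univ_poly_a_inv_degree[OF carrier_is_subring X] by (simp add: var_def)
    have m1: "polynomial (carrier R) ?M"
      using UP.nat_pow_closed[OF X, of ?Q] unfolding XQ by (simp add: univ_poly_carrier)
    have m2: "polynomial (carrier R) ?N" using X by (simp add: univ_poly_carrier)
    have ne: "Polynomials.degree ?M \<noteq> Polynomials.degree ?N" unfolding d1 d2 using Q by linarith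
    have "Polynomials.degree (poly_add ?M ?N) = max ?Q 1"
      using poly_add_degree_eq[OF carrier_is_subring m1 m2 ne] unfolding d1 d2 .
    moreover have "P = poly_add ?M ?N"
      unfolding P_def XQ a_minus_def univ_poly_add ..
    ultimately show ?thesis using Q by (simp only:)
  qed
  have P0: "P \<noteq> []"
  proof
    assume "P = []"
    then have "Polynomials.degree P = 0" by simp
    then show False using deg Q by linarith
  qed
  have eval_hom: "ring_hom_cring ?UP R (\<lambda>f. eval f a)" if "a \<in> carrier R" for a
    using eval_cring_hom[OF carrier_is_subring that] .
  have eval_X: "eval X a = a" if "a \<in> carrier R" for a using that by (rule eval_var)
  have eval_P: "eval P a = a [^] ?Q \<ominus> a" if a: "a \<in> carrier R" for a
  proof -
    interpret ev: ring_hom_cring ?UP R "\<lambda>f. eval f a" by (rule eval_hom[OF a])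
    show ?thesis
      unfolding P_def using X eval_X[OF a] by (simp add: a_minus_def ev.hom_add ev.hom_a_inv ev.hom_nat_pow)
  qed
  have root: "x \<in># roots P \<longleftrightarrow> x \<in> fixed_by_power ?Q" for x
    unfolding roots_mem_iff_is_root[OF P] is_root_def fixed_by_power_def
    using P0 eval_P by auto
  have simple: "count (roots P) a \<le> 1" for a
  proof (rule ccontr)
    assume "\<not> count (roots P) a \<le> 1"
    then have c: "count (roots P) a \<ge> 2" by simp
    then have m: "alg_mult P a \<ge> 2" by (simp add: alg_mult_eq_count_roots[OF P])
    have "count (roots P) a > 0" using c by linarith
    then have "a \<in># roots P" by (simp only: count_greater_zero_iff)
    then have a: "a \<in> carrier R" "a [^] ?Q = a" using root by (auto simp: fixed_by_power_def)
    \<comment> \<open>Y is the linear factor X - a and A the constant polynomial a. As a is fixed,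
      A^Q = A, whence P = Y^Q - Y.\<close>
    define Y where "Y = [\<one>, \<ominus> a]"
    define A where "A = poly_of_const a"
    have A: "A \<in> carrier ?UP" using a by (simp add: A_def)
    have Yc: "Y \<in> carrier ?UP"
      unfolding Y_def using a by (simp add: univ_poly_carrier[symmetric] polynomial_def)
    have XY: "X = Y \<oplus>\<^bsub>?UP\<^esub> A"
      using a by (cases "a = \<zero>")
        (auto simp: Y_def A_def var_def poly_of_const_def univ_poly_add l_neg)
    have AQ: "A [^]\<^bsub>?UP\<^esub> ?Q = A"
      unfolding A_def using const.hom_nat_pow[of a ?Q] a by simp
    have PY: "P = Y [^]\<^bsub>?UP\<^esub> ?Q \<ominus>\<^bsub>?UP\<^esub> Y"
    proof -
      have "P = (Y [^]\<^bsub>?UP\<^esub> ?Q \<oplus>\<^bsub>?UP\<^esub> A) \<ominus>\<^bsub>?UP\<^esub> (Y \<oplus>\<^bsub>?UP\<^esub> A)"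
        unfolding P_def XY UPc.frobenius_add[OF Yc A] AQ ..
      also have "\<dots> = Y [^]\<^bsub>?UP\<^esub> ?Q \<oplus>\<^bsub>?UP\<^esub> (A \<oplus>\<^bsub>?UP\<^esub> (\<ominus>\<^bsub>?UP\<^esub> Y \<oplus>\<^bsub>?UP\<^esub> \<ominus>\<^bsub>?UP\<^esub> A))"
        using Yc A by (simp add: UP.minus_eq UP.minus_add UP.a_assoc)
      also have "A \<oplus>\<^bsub>?UP\<^esub> (\<ominus>\<^bsub>?UP\<^esub> Y \<oplus>\<^bsub>?UP\<^esub> \<ominus>\<^bsub>?UP\<^esub> A) = \<ominus>\<^bsub>?UP\<^esub> Y"
        using Yc A by (simp add: UP.a_lcomm[of A] UP.r_neg)
      finally show ?thesis by (simp add: UP.minus_eq)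
    qed
    have "(Y [^]\<^bsub>?UP\<^esub> (2::nat)) pdivides P"
      unfolding Y_def by (rule le_alg_mult_imp_pdivides[OF a(1) P m])
    then obtain h where h: "h \<in> carrier ?UP" "P = Y [^]\<^bsub>?UP\<^esub> (2::nat) \<otimes>\<^bsub>?UP\<^esub> h"
      unfolding pdivides_def factor_def by auto
    obtain n where "?Q = 2 + n" using le_Suc_ex[OF Q] by blast
    then have n: "?Q = Suc (Suc n)" by simp
    \<comment> \<open>Suc n is Q - 1 >= 1. Cancelling one Y from Y^Q - Y = Y^2 h gives Y^(Q-1) - 1 =
      Y h, and evaluation at a, where Y vanishes, yields -1 = 0.\<close>
    have "Y \<otimes>\<^bsub>?UP\<^esub> (Y [^]\<^bsub>?UP\<^esub> (Suc n) \<ominus>\<^bsub>?UP\<^esub> \<one>\<^bsub>?UP\<^esub>) = Y [^]\<^bsub>?UP\<^esub> ?Q \<ominus>\<^bsub>?UP\<^esub> Y"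
      using Yc unfolding n
      by (simp add: UP.minus_eq UP.r_distr UP.r_minus UP.m_comm del: UP.nat_pow_Suc)
    also have "\<dots> = Y \<otimes>\<^bsub>?UP\<^esub> (Y \<otimes>\<^bsub>?UP\<^esub> h)"
      using Yc h PY by (simp add: numeral_2_eq_2 UP.m_assoc)
    finally have "Y \<otimes>\<^bsub>?UP\<^esub> (Y [^]\<^bsub>?UP\<^esub> (Suc n) \<ominus>\<^bsub>?UP\<^esub> \<one>\<^bsub>?UP\<^esub>) = Y \<otimes>\<^bsub>?UP\<^esub> (Y \<otimes>\<^bsub>?UP\<^esub> h)" .
    moreover have "Y \<noteq> \<zero>\<^bsub>?UP\<^esub>" by (simp add: Y_def univ_poly_zero)
    ultimately have eq: "Y [^]\<^bsub>?UP\<^esub> (Suc n) \<ominus>\<^bsub>?UP\<^esub> \<one>\<^bsub>?UP\<^esub> = Y \<otimes>\<^bsub>?UP\<^esub> h"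
      using Yc h by (subst (asm) UP.m_lcancel) auto
    interpret ev: ring_hom_cring ?UP R "\<lambda>f. eval f a" by (rule eval_hom[OF a(1)])
    have Ya: "eval Y a = \<zero>" using a by (simp add: Y_def r_neg)
    have "eval (Y [^]\<^bsub>?UP\<^esub> (Suc n) \<ominus>\<^bsub>?UP\<^esub> \<one>\<^bsub>?UP\<^esub>) a = \<ominus> \<one>"
      using Yc Ya by (simp add: a_minus_def ev.hom_add ev.hom_a_inv ev.hom_mult del: ev.hom_one)
        (use ev.hom_one in simp)
    moreover have "eval (Y \<otimes>\<^bsub>?UP\<^esub> h) a = \<zero>"
      using Yc Ya h ev.hom_closed by (simp add: ev.hom_mult)
    ultimately have "\<ominus> \<one> = \<zero>" using eq by simp
    then have "\<one> = \<zero>" by (metis add.inv_eq_1_iff one_closed)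
    then show False by simp
  qed
  \<comment> \<open>All multiplicities are 1, so the count with multiplicity, which is Q because P
    splits, is the number of distinct roots.\<close>
  have "size (roots P) = card (set_mset (roots P))"
  proof -
    have "roots P = mset_set (set_mset (roots P))"
    proof (rule multiset_eqI)
      fix x show "count (roots P) x = count (mset_set (set_mset (roots P))) x"
      proof (cases "x \<in># roots P")
        case True
        then have "count (roots P) x > 0" by (simp only: count_greater_zero_iff)
        then have "count (roots P) x = 1" using simple[of x] by linarith
        then show ?thesis using True by simp
      qed (simp add: not_in_iff)
    qed
    then show ?thesis by (metis size_mset_set)
  qed
  also have "set_mset (roots P) = fixed_by_power ?Q" using root by auto
  finally show ?thesis using split deg by (simp add: splitted_def P_def)
qed

text \<open>Both fields are cut out of one algebraic closure of Z/p as fixed points: K belongs to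
  the power p^(r s), and it contains the fixed points of the power p^r. The element type is that of
  the closure.\<close>

lemma finite_field_exists:
  assumes p: "prime p" and r: "r \<ge> 1" and s: "s \<ge> 1"
  obtains K :: "((int list \<times> nat) multiset \<Rightarrow> int) ring"
  where "field K" "card (carrier K) = p ^ (r * s)" "[p] \<cdot>\<^bsub>K\<^esub> \<one>\<^bsub>K\<^esub> = \<zero>\<^bsub>K\<^esub>"
    "card (ring.fixed_by_power K (p ^ r)) = p ^ r"
proof -
  let ?Zp = "residue_ring (int p)"
  interpret Zp: residues_prime p ?Zp by unfold_locales (use p in auto)
  obtain L :: "((int list \<times> nat) multiset \<Rightarrow> int) ring"
    where L: "algebraic_closure L (Zp.indexed_const ` carrier ?Zp)"
      and hom: "Zp.indexed_const \<in> Ring.ring_hom ?Zp L"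
    by (rule Zp.exists_closure)
  let ?K0 = "Zp.indexed_const ` carrier ?Zp"
  interpret L: algebraic_closure L ?K0 by (rule L)
  interpret h: ring_hom_cring ?Zp L Zp.indexed_const
    by (intro ring_hom_cring.intro ring_hom_cring_axioms.intro Zp.is_cring L.is_cring hom)
  have h_pow: "Zp.indexed_const ([m] \<cdot>\<^bsub>?Zp\<^esub> \<one>\<^bsub>?Zp\<^esub>) = [m] \<cdot>\<^bsub>L\<^esub> \<one>\<^bsub>L\<^esub>" for m :: nat
    by (induction m) (auto simp: Zp.add.nat_pow_Suc L.add.nat_pow_Suc)
  \<comment> \<open>The additive group of the residue ring has order p, so p 1 = 0 there, and the
    embedding transfers this to the closure.\<close>
  have "Coset.order (add_monoid ?Zp) = p" by (simp add: Coset.order_def residue_ring_def)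
  then have "[p] \<cdot>\<^bsub>?Zp\<^esub> \<one>\<^bsub>?Zp\<^esub> = \<zero>\<^bsub>?Zp\<^esub>"
    using Zp.add.pow_order_eq_1[of "\<one>\<^bsub>?Zp\<^esub>"] by simp
  then have char: "[p] \<cdot>\<^bsub>L\<^esub> \<one>\<^bsub>L\<^esub> = \<zero>\<^bsub>L\<^esub>" using h_pow[of p] by simp
  have card: "card (L.fixed_by_power (p ^ k)) = p ^ k" if k: "k \<ge> 1" for k
  proof (rule L.card_fixed_by_power[OF p char k])
    \<comment> \<open>The closure guarantees splitting for polynomials over the prime field
      \<open>?K0\<close>; X^(p^k) - X is one of them and is the same polynomial over L.\<close>
    have sr: "subring ?K0 L" using subfieldE(1)[OF L.subfield_axioms] .
    let ?P = "X\<^bsub>L\<^esub> [^]\<^bsub>?K0[X]\<^bsub>L\<^esub>\<^esub> (p ^ k) \<ominus>\<^bsub>?K0[X]\<^bsub>L\<^esub>\<^esub> X\<^bsub>L\<^esub>"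
    interpret KX: domain "?K0[X]\<^bsub>L\<^esub>" using L.univ_poly_is_domain[OF sr] .
    have X: "X\<^bsub>L\<^esub> \<in> carrier (?K0[X]\<^bsub>L\<^esub>)" by (rule L.var_closed(1)[OF sr])
    then have "L.splitted ?P" by (intro L.roots_over_subfield) simp
    moreover have "X\<^bsub>L\<^esub> [^]\<^bsub>?K0[X]\<^bsub>L\<^esub>\<^esub> (p ^ k) = X\<^bsub>L\<^esub> [^]\<^bsub>poly_ring L\<^esub> (p ^ k)"
      by (simp add: nat_pow_def univ_poly_def)
    ultimately show "L.splitted (X\<^bsub>L\<^esub> [^]\<^bsub>poly_ring L\<^esub> (p ^ k) \<ominus>\<^bsub>poly_ring L\<^esub> X\<^bsub>L\<^esub>)"
      using L.univ_poly_a_minus_consistent[OF sr X] by simp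
  qed
  define K where "K = L\<lparr>carrier := L.fixed_by_power (p ^ (r * s))\<rparr>"
  have sub: "subfield (L.fixed_by_power (p ^ (r * s))) L"
    by (rule L.subfield_fixed_by_power[OF p char])
  have fK: "field K" unfolding K_def using L.subfield_iff(2)[OF sub] .
  interpret K: field K by (rule fK)
  have pow: "x [^]\<^bsub>K\<^esub> (m::nat) = x [^]\<^bsub>L\<^esub> m" for x m by (simp add: K_def nat_pow_def)
  have "K.fixed_by_power (p ^ r) = L.fixed_by_power (p ^ r)"
  proof -
    \<comment> \<open>An element fixed by the p^r-th power is fixed by its iterates; the case j = s
      puts it into K.\<close>
    have "x [^]\<^bsub>L\<^esub> (p ^ (r * j)) = x" if "x \<in> carrier L" "x [^]\<^bsub>L\<^esub> (p ^ r) = x" for x j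
    proof (induction j)
      case (Suc j)
      have "x [^]\<^bsub>L\<^esub> (p ^ (r * Suc j)) = (x [^]\<^bsub>L\<^esub> (p ^ r)) [^]\<^bsub>L\<^esub> (p ^ (r * j))"
        using that(1) by (simp add: L.nat_pow_pow power_add)
      then show ?case using that(2) Suc by simp
    qed (use that in simp)
    then show ?thesis
      unfolding K.fixed_by_power_def L.fixed_by_power_def pow
      by (auto simp: K_def L.fixed_by_power_def)
  qed
  moreover have "[p] \<cdot>\<^bsub>K\<^esub> \<one>\<^bsub>K\<^esub> = \<zero>\<^bsub>K\<^esub>" using char by (simp add: K_def add_pow_def nat_pow_def)
  moreover have "card (carrier K) = p ^ (r * s)" using card[of "r * s"] r s by (simp add: K_def)
  ultimately show thesis using that[OF fK] card[OF r] by simp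
qed

section \<open>The extended evaluation code\<close>

text \<open>Newton's form: the solution is w y + (x - y) G(x), where G has one coefficient fewer and
  takes the values (w x - w y) / (x - y) on T.\<close>

lemma (in field) lagrange_interpolation:
  assumes "finite T" "T \<subseteq> carrier R" "card T \<le> l" "\<And>x. x \<in> T \<Longrightarrow> w x \<in> carrier R"
  shows "\<exists>g. (\<forall>j. g j \<in> carrier R) \<and> (\<forall>x\<in>T. (\<Oplus>j\<in>{..<l}. g j \<otimes> x [^] j) = w x)"
  using assms
proof (induction T arbitrary: w l rule: finite_induct)
  case empty
  then show ?case by (intro exI[of _ "\<lambda>_. \<zero>"]) simp
next
  case (insert y T)
  then obtain l' where l: "l = Suc l'" and l': "card T \<le> l'" by (cases l) auto
  have y: "y \<in> carrier R" "w y \<in> carrier R" using insert.prems by auto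
  have T: "x \<in> carrier R" "w x \<in> carrier R" "x \<ominus> y \<noteq> \<zero>" if "x \<in> T" for x
    using that insert y by auto
  define w' where "w' x = (w x \<ominus> w y) \<otimes> inv (x \<ominus> y)" for x
  have w'c: "w' x \<in> carrier R" if "x \<in> T" for x
    using T[OF that] y by (simp add: w'_def field_Units)
  have "T \<subseteq> carrier R" using insert.prems(1) by simp
  then have "\<exists>g. (\<forall>j. g j \<in> carrier R) \<and> (\<forall>x\<in>T. (\<Oplus>j\<in>{..<l'}. g j \<otimes> x [^] j) = w' x)"
    by (rule insert.IH[OF _ l' w'c])
  then obtain g where "\<forall>j. g j \<in> carrier R"
    and "\<forall>x\<in>T. (\<Oplus>j\<in>{..<l'}. g j \<otimes> x [^] j) = w' x" by blast
  then have gc: "\<And>j. g j \<in> carrier R"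
    and g: "\<And>x. x \<in> T \<Longrightarrow> (\<Oplus>j\<in>{..<l'}. g j \<otimes> x [^] j) = w' x" by auto
  \<comment> \<open>u lists the coefficients of w y + x G(x) and v those of y G(x), both up to index
    l', so u - v belongs to w y + (x - y) G(x).\<close>
  define u where "u j = (if j = 0 then w y else g (j - 1))" for j
  define v where "v j = (if j < l' then y \<otimes> g j else \<zero>)" for j
  have uc: "u j \<in> carrier R" and vc: "v j \<in> carrier R" for j
    using gc y by (auto simp: u_def v_def)
  have sum: "(\<Oplus>j\<in>{..<l}. (u j \<ominus> v j) \<otimes> x [^] j)
      = w y \<oplus> (x \<ominus> y) \<otimes> (\<Oplus>j\<in>{..<l'}. g j \<otimes> x [^] j)" if x: "x \<in> carrier R" for x
  proof -
    let ?G = "\<Oplus>j\<in>{..<l'}. g j \<otimes> x [^] j"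
    have G: "?G \<in> carrier R" using gc x by (auto intro!: finsum_closed)
    have "(\<Oplus>j\<in>{..<l}. (u j \<ominus> v j) \<otimes> x [^] j)
        = (\<Oplus>j\<in>{..<l}. u j \<otimes> x [^] j \<oplus> (\<ominus> \<one>) \<otimes> (v j \<otimes> x [^] j))"
      using uc vc x by (intro finsum_cong') (auto simp: minus_eq l_distr l_minus)
    also have "\<dots> = (\<Oplus>j\<in>{..<l}. u j \<otimes> x [^] j) \<oplus> (\<Oplus>j\<in>{..<l}. (\<ominus> \<one>) \<otimes> (v j \<otimes> x [^] j))"
      using uc vc x by (intro finsum_addf) auto
    also have "(\<Oplus>j\<in>{..<l}. (\<ominus> \<one>) \<otimes> (v j \<otimes> x [^] j)) = (\<ominus> \<one>) \<otimes> (\<Oplus>j\<in>{..<l}. v j \<otimes> x [^] j)"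
      using vc x by (intro finsum_rdistr[symmetric]) auto
    also have "(\<Oplus>j\<in>{..<l}. v j \<otimes> x [^] j) = (\<Oplus>j\<in>{..<l'}. y \<otimes> (g j \<otimes> x [^] j))"
    proof -
      have "(\<Oplus>j\<in>{..<l}. v j \<otimes> x [^] j) = v l' \<otimes> x [^] l' \<oplus> (\<Oplus>j\<in>{..<l'}. v j \<otimes> x [^] j)"
        unfolding l lessThan_Suc using vc x by (subst finsum_insert) auto
      also have "\<dots> = (\<Oplus>j\<in>{..<l'}. v j \<otimes> x [^] j)"
      proof -
        have "(\<Oplus>j\<in>{..<l'}. v j \<otimes> x [^] j) \<in> carrier R"
          using vc x by (auto intro!: finsum_closed)
        then show ?thesis using x by (simp add: v_def)
      qed
      also have "\<dots> = (\<Oplus>j\<in>{..<l'}. y \<otimes> (g j \<otimes> x [^] j))"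
        using gc y x by (intro finsum_cong') (auto simp: v_def m_assoc)
      finally show ?thesis .
    qed
    also have "\<dots> = y \<otimes> ?G" using gc x y by (intro finsum_rdistr[symmetric]) auto
    also have "(\<Oplus>j\<in>{..<l}. u j \<otimes> x [^] j) = w y \<oplus> (\<Oplus>j\<in>{..<l'}. x \<otimes> (g j \<otimes> x [^] j))"
    proof -
      have "(\<Oplus>j\<in>{..<l}. u j \<otimes> x [^] j) = u 0 \<otimes> x [^] (0::nat) \<oplus> (\<Oplus>j\<in>Suc ` {..<l'}. u j \<otimes> x [^] j)"
        unfolding l lessThan_Suc_eq_insert_0 using uc x by (subst finsum_insert) auto
      also have "(\<Oplus>j\<in>Suc ` {..<l'}. u j \<otimes> x [^] j) = (\<Oplus>j\<in>{..<l'}. u (Suc j) \<otimes> x [^] Suc j)"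
        using uc x by (intro finsum_reindex) (auto simp del: nat_pow_Suc)
      also have "\<dots> = (\<Oplus>j\<in>{..<l'}. x \<otimes> (g j \<otimes> x [^] j))"
        using gc x by (intro finsum_cong') (auto simp: u_def m_assoc m_comm[of x])
      finally show ?thesis using y by (simp add: u_def)
    qed
    also have "(\<Oplus>j\<in>{..<l'}. x \<otimes> (g j \<otimes> x [^] j)) = x \<otimes> ?G"
      using gc x by (intro finsum_rdistr[symmetric]) auto
    finally show ?thesis using x y G by (simp add: l_distr minus_eq l_minus a_assoc)
  qed
  show ?case
  proof (intro exI[of _ "\<lambda>j. u j \<ominus> v j"] conjI ballI allI)
    fix x assume x: "x \<in> insert y T"
    show "(\<Oplus>j\<in>{..<l}. (u j \<ominus> v j) \<otimes> x [^] j) = w x"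
    proof (cases "x = y")
      case True
      have "(\<Oplus>j\<in>{..<l'}. g j \<otimes> y [^] j) \<in> carrier R" using gc y by (auto intro!: finsum_closed)
      then show ?thesis unfolding True sum[OF y(1)] using y by (simp add: minus_eq r_neg)
    next
      case False
      then have xT: "x \<in> T" using x by simp
      have inv: "inv (x \<ominus> y) \<in> carrier R" "(x \<ominus> y) \<otimes> inv (x \<ominus> y) = \<one>"
        using T[OF xT] y by (auto simp: field_Units)
      have "(x \<ominus> y) \<otimes> w' x = (w x \<ominus> w y) \<otimes> ((x \<ominus> y) \<otimes> inv (x \<ominus> y))"
        using T[OF xT] y inv(1) by (simp add: w'_def m_lcomm)
      then have "(x \<ominus> y) \<otimes> w' x = w x \<ominus> w y" using inv T[OF xT] y by simp
      then show ?thesis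
        unfolding sum[OF T(1)[OF xT]] g[OF xT] using T[OF xT] y a_lcomm[of "w y" "w x" "\<ominus> w y"]
        by (simp add: minus_eq r_neg)
    qed
  qed (use uc vc in auto)
qed

lemma (in ring) geometric_sum:
  assumes y: "y \<in> carrier R"
  shows "(y \<ominus> \<one>) \<otimes> (\<Oplus>i\<in>{..<n}. y [^] i) = y [^] (n::nat) \<ominus> \<one>"
proof (induction n)
  case (Suc n)
  let ?S = "\<Oplus>i\<in>{..<n}. y [^] i"
  have S: "?S \<in> carrier R" using y by (auto intro!: finsum_closed)
  have "(\<Oplus>i\<in>{..<Suc n}. y [^] i) = y [^] n \<oplus> ?S"
    unfolding lessThan_Suc using y by (subst finsum_insert) auto
  then have "(y \<ominus> \<one>) \<otimes> (\<Oplus>i\<in>{..<Suc n}. y [^] i) = (y \<ominus> \<one>) \<otimes> y [^] n \<oplus> (y [^] n \<ominus> \<one>)"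
    using y S Suc.IH by (simp add: r_distr)
  also have "(y \<ominus> \<one>) \<otimes> y [^] n = y [^] Suc n \<ominus> y [^] n"
    using y nat_pow_comm[OF y, of "Suc 0" n] by (simp add: minus_eq l_distr l_minus)
  also have "(y [^] Suc n \<ominus> y [^] n) \<oplus> (y [^] n \<ominus> \<one>) = y [^] Suc n \<ominus> \<one>"
    using y by (simp add: minus_eq a_assoc r_neg2 r_neg1 del: nat_pow_Suc)
  finally show ?case .
qed (use y in \<open>simp add: minus_eq r_neg\<close>)

text \<open>Here \<omega> is a primitive n-th root of unity. Coprimality makes multiplication by q
  modulo n injective on \<Delta>, and oddness of q makes it fix n / 2.\<close>

locale extended_evaluation_code = field R for R (structure) +
  fixes p r n :: nat and \<omega> :: 'a and \<Delta> :: "nat set"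
  assumes finite_R: "finite (carrier R)"
    and p: "prime p" and char_p: "[p] \<cdot> \<one> = \<zero>"
    and p_dvd: "p dvd Suc n"
    and n_even: "even n" and n_pos: "n > 0"
    and odd_q: "odd (p ^ r)" and coprime_q: "coprime (p ^ r) n"
    and \<omega>: "\<omega> \<in> carrier R" and \<omega>_order: "\<omega> [^] (j::nat) = \<one> \<longleftrightarrow> n dvd j"
    and \<Delta>_le: "\<Delta> \<subseteq> {..n div 2}"
    and zero_in_\<Delta>: "0 \<in> \<Delta>" and m_in_\<Delta>: "n div 2 \<in> \<Delta>"
    and \<Delta>_closed: "a \<in> \<Delta> \<Longrightarrow> (p ^ r * a) mod n \<in> \<Delta>"
begin

sublocale char_p_cring R p
  by unfold_locales (use p char_p in auto)

abbreviation "q \<equiv> p ^ r"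
abbreviation "m \<equiv> n div 2"
abbreviation "A \<equiv> {..<Suc (Suc n)}"

text \<open>With \<open>n = N - 1\<close>, the coordinates \<open>0, \<dots>, n - 1\<close> are the \<open>n\<close>-th roots of unity, coordinate \<open>n\<close>
  is the point 0 and coordinate \<open>n + 1\<close> records the coefficient of \<open>X^m\<close>.\<close>
definition pt :: "nat \<Rightarrow> 'a" where
  "pt i = (if i < n then \<omega> [^] i else \<zero>)"

definition val :: "(nat \<Rightarrow> 'a) \<Rightarrow> 'a \<Rightarrow> 'a" where
  "val f x = (\<Oplus>a\<in>\<Delta>. f a \<otimes> x [^] a)"

definition ev :: "(nat \<Rightarrow> 'a) \<Rightarrow> nat \<Rightarrow> 'a" where
  "ev f = (\<lambda>i\<in>A. if i \<le> n then val f (pt i) else f m)"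

definition V :: "(nat \<Rightarrow> 'a) set" where
  "V = ev ` {f. \<forall>a\<in>\<Delta>. f a \<in> carrier R}"

lemma finite_\<Delta>: "finite \<Delta>"
  using \<Delta>_le by (auto intro: finite_subset)

lemma m_bounds: "0 < m" "m < n" "m + m = n"
  using n_even n_pos by auto

lemma \<Delta>_lt: "a \<in> \<Delta> \<Longrightarrow> a \<le> m" "a \<in> \<Delta> \<Longrightarrow> a < n"
  using \<Delta>_le m_bounds by fastforce+

lemma pt_closed [simp]: "pt i \<in> carrier R"
  using \<omega> by (simp add: pt_def)

lemma val_closed [simp]: "\<forall>a\<in>\<Delta>. f a \<in> carrier R \<Longrightarrow> x \<in> carrier R \<Longrightarrow> val f x \<in> carrier R"
  unfolding val_def by (auto intro!: finsum_closed)

lemma ev_closed [simp]: "\<forall>a\<in>\<Delta>. f a \<in> carrier R \<Longrightarrow> i \<in> A \<Longrightarrow> ev f i \<in> carrier R"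
  using m_in_\<Delta> by (auto simp: ev_def)

lemma val_add_smult:
  assumes f: "\<forall>a\<in>\<Delta>. f a \<in> carrier R" and g: "\<forall>a\<in>\<Delta>. g a \<in> carrier R"
    and c: "c \<in> carrier R" and x: "x \<in> carrier R"
  shows "val (\<lambda>a. f a \<oplus> c \<otimes> g a) x = val f x \<oplus> c \<otimes> val g x"
proof -
  have "val (\<lambda>a. f a \<oplus> c \<otimes> g a) x = (\<Oplus>a\<in>\<Delta>. f a \<otimes> x [^] a \<oplus> c \<otimes> (g a \<otimes> x [^] a))"
    unfolding val_def using assms by (intro finsum_cong') (auto simp: l_distr m_assoc)
  also have "\<dots> = (\<Oplus>a\<in>\<Delta>. f a \<otimes> x [^] a) \<oplus> (\<Oplus>a\<in>\<Delta>. c \<otimes> (g a \<otimes> x [^] a))"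
    using assms by (intro finsum_addf) auto
  also have "(\<Oplus>a\<in>\<Delta>. c \<otimes> (g a \<otimes> x [^] a)) = c \<otimes> (\<Oplus>a\<in>\<Delta>. g a \<otimes> x [^] a)"
    using assms finite_\<Delta> by (intro finsum_rdistr[symmetric]) auto
  finally show ?thesis by (simp add: val_def)
qed

lemma val_monomial:
  assumes "b \<in> \<Delta>" "c \<in> carrier R" "x \<in> carrier R"
  shows "val (\<lambda>a. if a = b then c else \<zero>) x = c \<otimes> x [^] b"
proof -
  have "val (\<lambda>a. if a = b then c else \<zero>) x = (\<Oplus>a\<in>\<Delta>. if b = a then c \<otimes> x [^] a else \<zero>)"
    unfolding val_def using assms by (intro finsum_cong') auto
  also have "\<dots> = c \<otimes> x [^] b"
    using assms finite_\<Delta> by (intro add.finprod_singleton) auto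
  finally show ?thesis .
qed

text \<open>Factoring out x^a leaves a polynomial with l free coefficients, to which Lagrange
  interpolation applies.\<close>

lemma val_run:
  assumes run: "{a..<a + l} \<subseteq> \<Delta>" and g: "\<And>j. g j \<in> carrier R" and x: "x \<in> carrier R"
  shows "val (\<lambda>j. if a \<le> j \<and> j < a + l then g (j - a) else \<zero>) x
    = x [^] a \<otimes> (\<Oplus>j\<in>{..<l}. g j \<otimes> x [^] j)"
proof -
  have "val (\<lambda>j. if a \<le> j \<and> j < a + l then g (j - a) else \<zero>) x
      = (\<Oplus>j\<in>{a..<a + l}. g (j - a) \<otimes> x [^] j)"
    unfolding val_def using run g x finite_\<Delta>
    by (intro add.finprod_mono_neutral_cong_right) auto
  also have "{a..<a + l} = (\<lambda>j. a + j) ` {..<l}"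
    using image_add_atLeastLessThan[of a 0 l] by (simp add: lessThan_atLeast0 add.commute)
  also have "(\<Oplus>j\<in>(\<lambda>j. a + j) ` {..<l}. g (j - a) \<otimes> x [^] j)
      = (\<Oplus>j\<in>{..<l}. g (a + j - a) \<otimes> x [^] (a + j))"
    using g x by (intro finsum_reindex) auto
  also have "\<dots> = (\<Oplus>j\<in>{..<l}. x [^] a \<otimes> (g j \<otimes> x [^] j))"
    using g x by (intro finsum_cong') (auto simp: nat_pow_mult[symmetric] m_lcomm)
  also have "\<dots> = x [^] a \<otimes> (\<Oplus>j\<in>{..<l}. g j \<otimes> x [^] j)"
    using g x by (intro finsum_rdistr[symmetric]) auto
  finally show ?thesis .
qed

lemma ev_add_smult:
  assumes "\<forall>a\<in>\<Delta>. f a \<in> carrier R" "\<forall>a\<in>\<Delta>. g a \<in> carrier R" "c \<in> carrier R"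
  shows "ev (\<lambda>a. f a \<oplus> c \<otimes> g a) = (\<lambda>i\<in>A. ev f i \<oplus> c \<otimes> ev g i)"
  unfolding ev_def using val_add_smult[OF assms] by (intro restrict_ext) simp

sublocale V: linear_code R "carrier R" A V
proof (intro linear_code.intro linear_code_axioms.intro)
  show "field R" by (rule field_axioms)
  show "subfield (carrier R) R" by (rule carrier_is_subfield)
  show "finite A" by simp
  show "V \<subseteq> A \<rightarrow>\<^sub>E carrier R"
    unfolding V_def by (auto simp: PiE_def extensional_def) (simp add: ev_def)
  have "val (\<lambda>_. \<zero>) x = \<zero>" if "x \<in> carrier R" for x
    unfolding val_def using that by (intro add.finprod_one_eqI) auto
  then have "ev (\<lambda>_. \<zero>) = (\<lambda>i\<in>A. \<zero>)" unfolding ev_def by (intro restrict_ext) simp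
  moreover have "ev (\<lambda>_. \<zero>) \<in> V" unfolding V_def by (intro imageI) simp
  ultimately show "(\<lambda>i\<in>A. \<zero>) \<in> V" by (simp only:)
  fix u v c assume "u \<in> V" "v \<in> V" "c \<in> carrier R"
  then obtain f g where fg: "\<forall>a\<in>\<Delta>. f a \<in> carrier R" "u = ev f" "\<forall>a\<in>\<Delta>. g a \<in> carrier R" "v = ev g"
    and c: "c \<in> carrier R" by (auto simp: V_def)
  have "(\<lambda>i\<in>A. u i \<oplus> c \<otimes> v i) = ev (\<lambda>a. f a \<oplus> c \<otimes> g a)"
    using ev_add_smult fg c by simp
  also have "\<dots> \<in> V" unfolding V_def using fg c by (intro imageI) simp
  finally show "(\<lambda>i\<in>A. u i \<oplus> c \<otimes> v i) \<in> V" .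
qed

section \<open>Evaluation points, power sums and self-orthogonality\<close>

lemma \<omega>_nonzero: "\<omega> \<noteq> \<zero>"
proof
  assume "\<omega> = \<zero>"
  then have "\<omega> [^] n = \<zero>" using n_pos by (simp add: nat_pow_zero)
  then show False using \<omega>_order[of n] by simp
qed

lemma pt_nonzero: "i < n \<Longrightarrow> pt i \<noteq> \<zero>"
proof -
  have "\<omega> [^] k \<noteq> \<zero>" for k :: nat
    by (induction k) (use \<omega>_nonzero \<omega> integral in auto)
  then show "i < n \<Longrightarrow> pt i \<noteq> \<zero>" by (simp add: pt_def)
qed

lemma pt_pow_n: "i < n \<Longrightarrow> pt i [^] n = \<one>"
  using \<omega> \<omega>_order[of "i * n"] by (simp add: pt_def nat_pow_pow)

lemma \<omega>_pow_eq:
  assumes "i < n" "j < n" "\<omega> [^] i = \<omega> [^] j" "i \<le> j"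
  shows "i = j"
proof -
  have c: "\<omega> [^] i \<in> carrier R" "\<omega> [^] (j - i) \<in> carrier R" using \<omega> by auto
  have "(\<omega> [^] i \<otimes> \<omega> [^] (j - i) = \<omega> [^] i \<otimes> \<one>)"
    using assms(3,4) nat_pow_mult[OF \<omega>, of i "j - i"] c by simp
  then have "\<omega> [^] (j - i) = \<one>"
    using c pt_nonzero[OF assms(1)] assms(1) m_lcancel[of "\<omega> [^] i" "\<omega> [^] (j - i)" \<one>]
    unfolding pt_def by simp
  then have "n dvd j - i" using \<omega>_order by simp
  then show ?thesis using assms by (auto dest: dvd_imp_le)
qed

lemma inj_pt: "inj_on pt {..n}"
proof (rule inj_onI)
  fix i j assume ij: "i \<in> {..n}" "j \<in> {..n}" "pt i = pt j"
  show "i = j"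
  proof (cases "i < n \<and> j < n")
    case True
    then show ?thesis
      using ij \<omega>_pow_eq[of i j] \<omega>_pow_eq[of j i] by (cases "i \<le> j") (auto simp: pt_def)
  next
    case False
    have zero: "pt n = \<zero>" by (simp add: pt_def)
    from False have "i = n \<or> j = n" using ij by auto
    then show ?thesis
    proof
      assume i: "i = n"
      then have "\<not> j < n" using ij(3) zero pt_nonzero[of j] by auto
      then show ?thesis using i ij by simp
    next
      assume j: "j = n"
      then have "\<not> i < n" using ij(3) zero pt_nonzero[of i] by auto
      then show ?thesis using j ij by simp
    qed
  qed
qed

text \<open>Over the roots of unity this is a geometric series with ratio \<omega>^j, which vanishes
  unless the ratio is 1.\<close>

lemma power_sum:
  assumes j: "j \<le> n"
  shows "(\<Oplus>i\<in>{..n}. pt i [^] j) = (if j = n then \<ominus> \<one> else \<zero>)"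
proof -
  let ?y = "\<omega> [^] j" and ?S = "\<Oplus>i\<in>{..<n}. pt i [^] j"
  have y: "?y \<in> carrier R" using \<omega> by simp
  have S: "?S \<in> carrier R" by (auto intro!: finsum_closed)
  have S_geo: "?S = (\<Oplus>i\<in>{..<n}. ?y [^] i)"
    using \<omega> by (intro finsum_cong') (auto simp: pt_def nat_pow_pow mult.commute)
  have "(\<Oplus>i\<in>{..n}. pt i [^] j) = pt n [^] j \<oplus> ?S"
    unfolding lessThan_Suc_atMost[symmetric] lessThan_Suc by (subst finsum_insert) auto
  then have split: "(\<Oplus>i\<in>{..n}. pt i [^] j) = \<zero> [^] j \<oplus> ?S" by (simp add: pt_def)
  show ?thesis
  proof (cases "?y = \<one>")
    case True
    have "?S = (\<Oplus>i\<in>{..<n}. \<one>)"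
      unfolding S_geo True by (intro finsum_cong') auto
    also have "\<dots> = [n] \<cdot> \<one>" by (simp add: add.finprod_const)
    finally have "?S \<oplus> \<one> = [(Suc n)] \<cdot> \<one>" by (simp add: add.nat_pow_Suc)
    also have "\<dots> = \<zero>" using p_dvd by (intro p_mult_zero) auto
    finally have eq: "?S = \<ominus> \<one>" using S by (metis minus_equality one_closed)
    \<comment> \<open>Ratio 1 leaves j = 0 and j = n. For j = 0 the point 0 contributes 0^0 = 1 and
      the total is n + 1 = 0; for j = n it contributes nothing and n = -1 remains.\<close>
    have "n dvd j" using True \<omega>_order by simp
    then have "j = 0 \<or> j = n" using j by (auto dest: dvd_imp_le)
    then show ?thesis unfolding split eq using n_pos by (auto simp: nat_pow_zero r_neg)
  next
    case False
    have "(?y \<ominus> \<one>) \<otimes> ?S = ?y [^] n \<ominus> \<one>" unfolding S_geo by (rule geometric_sum[OF y])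
    also have "?y [^] n = \<one>" using \<omega> \<omega>_order[of "j * n"] by (simp add: nat_pow_pow)
    finally have "(?y \<ominus> \<one>) \<otimes> ?S = \<zero>" by simp
    moreover have "?y \<ominus> \<one> \<noteq> \<zero>" using False y by simp
    ultimately have "?S = \<zero>" using integral[of "?y \<ominus> \<one>" ?S] S y by auto
    moreover have "\<not> n dvd j" using False \<omega>_order[of j] by simp
    then have "j \<noteq> 0" "j \<noteq> n" by (intro notI; simp)+
    ultimately show ?thesis unfolding split by (simp add: nat_pow_zero)
  qed
qed

text \<open>Only exponents with a + b = n survive the summation; as a and b are at most m = n / 2,
  this forces a = b = m.\<close>

lemma sum_val_pow:
  assumes f: "\<forall>a\<in>\<Delta>. f a \<in> carrier R" and b: "b \<in> \<Delta>"
  shows "(\<Oplus>i\<in>{..n}. val f (pt i) \<otimes> pt i [^] b) = (if b = m then \<ominus> f m else \<zero>)"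
proof -
  have "(\<Oplus>i\<in>{..n}. val f (pt i) \<otimes> pt i [^] b)
      = (\<Oplus>i\<in>{..n}. \<Oplus>a\<in>\<Delta>. f a \<otimes> pt i [^] (a + b))"
  proof (intro finsum_cong')
    fix i assume "i \<in> {..n}"
    have "val f (pt i) \<otimes> pt i [^] b = (\<Oplus>a\<in>\<Delta>. (f a \<otimes> pt i [^] a) \<otimes> pt i [^] b)"
      unfolding val_def using f finite_\<Delta> by (intro finsum_ldistr) auto
    also have "\<dots> = (\<Oplus>a\<in>\<Delta>. f a \<otimes> pt i [^] (a + b))"
      using f by (intro finsum_cong') (auto simp: m_assoc nat_pow_mult)
    finally show "val f (pt i) \<otimes> pt i [^] b = (\<Oplus>a\<in>\<Delta>. f a \<otimes> pt i [^] (a + b))" .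
  qed (use f in \<open>auto intro!: finsum_closed\<close>)
  also have "\<dots> = (\<Oplus>a\<in>\<Delta>. \<Oplus>i\<in>{..n}. f a \<otimes> pt i [^] (a + b))"
    using f finite_\<Delta> by (intro finsum_finsum_swap) auto
  also have "\<dots> = (\<Oplus>a\<in>\<Delta>. if m = a then (if b = m then \<ominus> f a else \<zero>) else \<zero>)"
  proof (intro finsum_cong')
    fix a assume a: "a \<in> \<Delta>"
    then have le: "a + b \<le> n" and eq: "a + b = n \<longleftrightarrow> a = m \<and> b = m"
      using \<Delta>_lt(1)[of a] \<Delta>_lt(1)[of b] b m_bounds by auto
    have "(\<Oplus>i\<in>{..n}. f a \<otimes> pt i [^] (a + b)) = f a \<otimes> (\<Oplus>i\<in>{..n}. pt i [^] (a + b))"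
      using f a by (intro finsum_rdistr[symmetric]) auto
    also have "\<dots> = (if m = a then (if b = m then \<ominus> f a else \<zero>) else \<zero>)"
      unfolding power_sum[OF le] eq using f a by (auto simp: r_minus)
    finally show "(\<Oplus>i\<in>{..n}. f a \<otimes> pt i [^] (a + b))
      = (if m = a then (if b = m then \<ominus> f a else \<zero>) else \<zero>)" .
  qed (use f in auto)
  also have "\<dots> = (if b = m then \<ominus> f m else \<zero>)"
    using f m_in_\<Delta> finite_\<Delta> by (intro add.finprod_singleton) auto
  finally show ?thesis .
qed

lemma V_self_orthogonal:
  assumes "u \<in> V" "v \<in> V"
  shows "(\<Oplus>i\<in>A. u i \<otimes> v i) = \<zero>"
proof -
  obtain f g where f: "\<forall>a\<in>\<Delta>. f a \<in> carrier R" "u = ev f" and g: "\<forall>a\<in>\<Delta>. g a \<in> carrier R" "v = ev g"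
    using assms by (auto simp: V_def)
  have fm: "f m \<in> carrier R" "g m \<in> carrier R" using f g m_in_\<Delta> by auto
  have "(\<Oplus>i\<in>{..n}. u i \<otimes> v i) = (\<Oplus>i\<in>{..n}. \<Oplus>b\<in>\<Delta>. g b \<otimes> (val f (pt i) \<otimes> pt i [^] b))"
  proof (intro finsum_cong')
    fix i assume "i \<in> {..n}"
    then have "u i \<otimes> v i = val f (pt i) \<otimes> val g (pt i)" using f g by (simp add: ev_def)
    also have "\<dots> = (\<Oplus>b\<in>\<Delta>. val f (pt i) \<otimes> (g b \<otimes> pt i [^] b))"
      unfolding val_def[of g] using f g finite_\<Delta> by (intro finsum_rdistr) auto
    also have "\<dots> = (\<Oplus>b\<in>\<Delta>. g b \<otimes> (val f (pt i) \<otimes> pt i [^] b))"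
      using f g by (intro finsum_cong') (auto simp: m_lcomm)
    finally show "u i \<otimes> v i = (\<Oplus>b\<in>\<Delta>. g b \<otimes> (val f (pt i) \<otimes> pt i [^] b))" .
  qed (use f g in \<open>auto intro!: finsum_closed\<close>)
  also have "\<dots> = (\<Oplus>b\<in>\<Delta>. \<Oplus>i\<in>{..n}. g b \<otimes> (val f (pt i) \<otimes> pt i [^] b))"
    using f g finite_\<Delta> by (intro finsum_finsum_swap) auto
  also have "\<dots> = (\<Oplus>b\<in>\<Delta>. if m = b then \<ominus> (g b \<otimes> f m) else \<zero>)"
  proof (intro finsum_cong')
    fix b assume b: "b \<in> \<Delta>"
    have "(\<Oplus>i\<in>{..n}. g b \<otimes> (val f (pt i) \<otimes> pt i [^] b))
        = g b \<otimes> (\<Oplus>i\<in>{..n}. val f (pt i) \<otimes> pt i [^] b)"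
      using f g b by (intro finsum_rdistr[symmetric]) auto
    then show "(\<Oplus>i\<in>{..n}. g b \<otimes> (val f (pt i) \<otimes> pt i [^] b))
        = (if m = b then \<ominus> (g b \<otimes> f m) else \<zero>)"
      unfolding sum_val_pow[OF f(1) b] using g b fm by (auto simp: r_minus)
  qed (use g fm in auto)
  also have "\<dots> = \<ominus> (g m \<otimes> f m)"
    using g fm m_in_\<Delta> finite_\<Delta> by (intro add.finprod_singleton) auto
  finally have s: "(\<Oplus>i\<in>{..n}. u i \<otimes> v i) = \<ominus> (g m \<otimes> f m)" .
  have inf: "u (Suc n) = f m" "v (Suc n) = g m" using f g by (simp_all add: ev_def)
  have c: "u i \<in> carrier R" "v i \<in> carrier R" if "i \<in> A" for i using that f g by auto
  have "A = insert (Suc n) {..n}" by auto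
  then have "(\<Oplus>i\<in>A. u i \<otimes> v i) = u (Suc n) \<otimes> v (Suc n) \<oplus> (\<Oplus>i\<in>{..n}. u i \<otimes> v i)"
    using c by (simp add: finsum_insert)
  then show ?thesis unfolding s inf using fm by (simp add: m_comm[of "g m"] r_neg)
qed

section \<open>Stability under Frobenius\<close>

lemma pow_mult_q:
  assumes i: "i \<le> n" and a: "a \<in> \<Delta>"
  shows "(pt i [^] a) [^] q = pt i [^] ((q * a) mod n)"
proof (cases "i < n")
  case True
  have "pt i [^] (q * a) = pt i [^] (n * ((q * a) div n) + (q * a) mod n)" by simp
  also have "\<dots> = (pt i [^] n) [^] ((q * a) div n) \<otimes> pt i [^] ((q * a) mod n)"
    by (simp only: nat_pow_mult[symmetric] nat_pow_pow pt_closed)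
  also have "\<dots> = pt i [^] ((q * a) mod n)" by (simp add: pt_pow_n[OF True])
  finally show ?thesis by (simp add: nat_pow_pow mult.commute)
next
  case False
  \<comment> \<open>At the point 0, reducing modulo n must not turn a positive exponent into 0,
    since 0^0 = 1; coprimality of q and n together with a < n prevents this.\<close>
  have "(q * a) mod n = 0 \<longleftrightarrow> a = 0"
  proof
    assume "(q * a) mod n = 0"
    then have "n dvd a" using coprime_q by (simp add: coprime_commute coprime_dvd_mult_right_iff mod_eq_0_iff_dvd)
    then show "a = 0" using \<Delta>_lt(2)[OF a] by (auto dest: dvd_imp_le)
  qed simp
  moreover have "q * a = 0 \<longleftrightarrow> a = 0" using p by (simp add: prime_gt_0_nat)
  moreover have "q \<noteq> 0" using p by (simp add: prime_gt_0_nat)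
  ultimately show ?thesis
    using False by (cases "a = 0") (auto simp: pt_def nat_pow_zero)
qed

text \<open>As a function on the points, the q-th power of a polynomial has its coefficients raised
  to the q-th power and its exponents permuted by \<open>\<sigma>\<close>. Since
  \<open>\<sigma>\<close> fixes m, the extra coordinate follows the same rule.\<close>

lemma V_frobenius:
  assumes "v \<in> V"
  shows "(\<lambda>i\<in>A. v i [^] q) \<in> V"
proof -
  obtain f where f: "\<forall>a\<in>\<Delta>. f a \<in> carrier R" "v = ev f" using assms by (auto simp: V_def)
  define \<sigma> where "\<sigma> a = (q * a) mod n" for a
  have inj: "inj_on \<sigma> \<Delta>"
  proof (rule inj_onI)
    fix a b assume ab: "a \<in> \<Delta>" "b \<in> \<Delta>" "\<sigma> a = \<sigma> b"
    then have "[q * a = q * b] (mod n)" by (simp add: \<sigma>_def cong_def)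
    then have "[a = b] (mod n)" using coprime_q by (simp add: cong_mult_lcancel_nat)
    then show "a = b" using ab \<Delta>_lt(2) by (simp add: cong_def)
  qed
  have "\<sigma> ` \<Delta> \<subseteq> \<Delta>" using \<Delta>_closed by (auto simp: \<sigma>_def)
  then have img: "\<sigma> ` \<Delta> = \<Delta>" using endo_inj_surj[OF finite_\<Delta> _ inj] by blast
  \<comment> \<open>With q = 2k + 1 and n = 2m, q m = m + k n.\<close>
  have \<sigma>m: "\<sigma> m = m"
  proof -
    obtain k where k: "q = 2 * k + 1" using odd_q by (elim oddE)
    have "q * m = m + k * (m + m)" unfolding k by (simp add: algebra_simps)
    then show ?thesis unfolding \<sigma>_def m_bounds(3) using m_bounds(2) by simp
  qed
  define g where "g b = f (inv_into \<Delta> \<sigma> b) [^] q" for b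
  have g\<sigma>: "g (\<sigma> a) = f a [^] q" if "a \<in> \<Delta>" for a using inj that by (simp add: g_def)
  have g: "\<forall>b\<in>\<Delta>. g b \<in> carrier R"
    using f img by (metis g\<sigma> imageE nat_pow_closed)
  have "val f (pt i) [^] q = val g (pt i)" if i: "i \<le> n" for i
  proof -
    have "val f (pt i) [^] q = (\<Oplus>a\<in>\<Delta>. (f a \<otimes> pt i [^] a) [^] q)"
      unfolding val_def using f by (intro frobenius_finsum) auto
    also have "\<dots> = (\<Oplus>a\<in>\<Delta>. g (\<sigma> a) \<otimes> pt i [^] \<sigma> a)"
      using f i by (intro finsum_cong') (auto simp: nat_pow_distrib pow_mult_q g\<sigma> \<sigma>_def[symmetric])
    also have "\<dots> = (\<Oplus>b\<in>\<sigma> ` \<Delta>. g b \<otimes> pt i [^] b)"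
      using g img inj by (intro finsum_reindex[symmetric]) auto
    finally show ?thesis by (simp add: img val_def)
  qed
  moreover have "f m [^] q = g m" using g\<sigma>[OF m_in_\<Delta>] \<sigma>m by simp
  ultimately have "(\<lambda>i\<in>A. v i [^] q) = ev g"
    unfolding f(2) ev_def by (intro restrict_ext) auto
  also have "\<dots> \<in> V" unfolding V_def using g by (intro imageI) simp
  finally show ?thesis .
qed

section \<open>Interpolation on few coordinates\<close>

lemma interpolate_points:
  assumes run: "{a..<a + l} \<subseteq> \<Delta>" and S: "S \<subseteq> {..n}" "card S \<le> l"
    and w: "\<And>i. i \<in> S \<Longrightarrow> w i \<in> carrier R"
  shows "\<exists>f. (\<forall>j\<in>\<Delta>. f j \<in> carrier R) \<and> (\<forall>i\<in>S. val f (pt i) = w i)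
    \<and> (m \<notin> {a..<a + l} \<longrightarrow> f m = \<zero>)"
proof -
  have fin: "finite S" using S by (auto intro: finite_subset)
  \<comment> \<open>If a > 0, everything supported on the run vanishes at the point 0, which is
    coordinate n. The constant c, available because 0 is in \<Delta>, supplies the value
    there.\<close>
  define c where "c = (if 0 < a \<and> n \<in> S then w n else \<zero>)"
  have c: "c \<in> carrier R" using w by (simp add: c_def)
  define S' where "S' = (if a = 0 then S else S - {n})"
  have S'S: "S' \<subseteq> S" by (auto simp: S'_def)
  have pow: "pt i [^] a \<in> Units R" if "i \<in> S'" for i
  proof (cases "a = 0")
    case False
    then have "i < n" using that S by (auto simp: S'_def)
    then have "pt i \<in> Units R" using pt_nonzero by (simp add: field_Units)
    then show ?thesis by (rule Units_pow_closed)
  qed simp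
  \<comment> \<open>The value that the factor behind x^a must take, once c has been subtracted;
    \<open>S'\<close> keeps the points where x^a is invertible.\<close>
  define w' where "w' x = (w (inv_into {..n} pt x) \<ominus> c) \<otimes> inv (x [^] a)" for x
  have inv_pt: "inv_into {..n} pt (pt i) = i" if "i \<in> S'" for i
    using that S'S S inj_pt by (intro inv_into_f_f) auto
  have "card (pt ` S') \<le> card S'" using fin S'S by (intro card_image_le) (auto intro: finite_subset)
  also have "card S' \<le> card S" using fin S'S by (rule card_mono)
  finally have "card (pt ` S') \<le> l" using S(2) by simp
  moreover have "w' x \<in> carrier R" if "x \<in> pt ` S'" for x
    using that inv_pt w S'S c pow by (auto simp: w'_def)
  moreover have "finite (pt ` S')" using fin S'S by (auto intro: finite_subset)
  moreover have "pt ` S' \<subseteq> carrier R" by auto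
  ultimately have "\<exists>g. (\<forall>j. g j \<in> carrier R)
      \<and> (\<forall>x\<in>pt ` S'. (\<Oplus>j\<in>{..<l}. g j \<otimes> x [^] j) = w' x)"
    by (intro lagrange_interpolation)
  then obtain g where "\<forall>j. g j \<in> carrier R"
    and "\<forall>x\<in>pt ` S'. (\<Oplus>j\<in>{..<l}. g j \<otimes> x [^] j) = w' x" by blast
  then have g: "\<And>j. g j \<in> carrier R"
    and gw: "\<And>x. x \<in> pt ` S' \<Longrightarrow> (\<Oplus>j\<in>{..<l}. g j \<otimes> x [^] j) = w' x" by auto
  define f0 where "f0 j = (if a \<le> j \<and> j < a + l then g (j - a) else \<zero>)" for j
  define f1 where "f1 j = (if j = 0 then c else \<zero>)" for j :: nat
  define f where "f j = f0 j \<oplus> \<one> \<otimes> f1 j" for j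
  have f01: "\<forall>j\<in>\<Delta>. f0 j \<in> carrier R" "\<forall>j\<in>\<Delta>. f1 j \<in> carrier R" using g c by (auto simp: f0_def f1_def)
  have val_f: "val f x = x [^] a \<otimes> (\<Oplus>j\<in>{..<l}. g j \<otimes> x [^] j) \<oplus> c" if x: "x \<in> carrier R" for x
  proof -
    have "val f x = val f0 x \<oplus> \<one> \<otimes> val f1 x"
      unfolding f_def using val_add_smult[OF f01 one_closed x] .
    also have "val f0 x = x [^] a \<otimes> (\<Oplus>j\<in>{..<l}. g j \<otimes> x [^] j)"
      unfolding f0_def by (rule val_run[OF run g x])
    also have "val f1 x = c" unfolding f1_def using val_monomial[OF zero_in_\<Delta> c x] c by simp
    finally show ?thesis using c by simp
  qed
  have "val f (pt i) = w i" if i: "i \<in> S" for i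
  proof (cases "i \<in> S'")
    case True
    then have "val f (pt i) = pt i [^] a \<otimes> w' (pt i) \<oplus> c" using val_f[of "pt i"] gw by simp
    also have "pt i [^] a \<otimes> w' (pt i) = (w i \<ominus> c) \<otimes> (pt i [^] a \<otimes> inv (pt i [^] a))"
      using w[OF i] c pow[OF True] by (simp add: w'_def inv_pt[OF True] m_lcomm)
    also have "\<dots> = w i \<ominus> c" using w[OF i] c pow[OF True] by simp
    also have "w i \<ominus> c \<oplus> c = w i" using w[OF i] c by (simp add: minus_eq a_assoc l_neg)
    finally show ?thesis .
  next
    case False
    then have ia: "i = n" "a > 0" using i by (auto simp: S'_def split: if_splits)
    then have "pt i [^] a = \<zero>" by (simp add: pt_def nat_pow_zero)
    moreover have "(\<Oplus>j\<in>{..<l}. g j \<otimes> pt i [^] j) \<in> carrier R" using g by (auto intro!: finsum_closed)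
    ultimately show ?thesis using val_f[of "pt i"] i ia c w by (simp add: c_def)
  qed
  \<comment> \<open>As m > 0, the added constant does not touch the coefficient of X^m.\<close>
  moreover have "f m = \<zero>" if "m \<notin> {a..<a + l}"
    using that m_bounds(1) by (auto simp: f_def f0_def f1_def)
  moreover have "\<forall>j\<in>\<Delta>. f j \<in> carrier R" using f01 by (simp add: f_def)
  ultimately show ?thesis by blast
qed

lemma V_interpolates:
  assumes run: "{a..<a + t} \<subseteq> \<Delta>" and S: "S \<subseteq> A" "card S \<le> t"
  shows "V.interpolates S"
  unfolding V.interpolates_def
proof (intro conjI allI impI)
  show "S \<subseteq> A" by (rule S(1))
  fix w assume w: "\<forall>i\<in>S. w i \<in> carrier R"
  show "\<exists>v\<in>V. \<forall>i\<in>S. v i = w i"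
  proof (cases "Suc n \<in> S")
    case False
    then have "i \<le> n" if "i \<in> S" for i using that S(1) by (force simp: less_Suc_eq_le le_Suc_eq)
    then have Sn: "S \<subseteq> {..n}" by auto
    obtain f where f: "\<forall>j\<in>\<Delta>. f j \<in> carrier R" "\<forall>i\<in>S. val f (pt i) = w i"
      using interpolate_points[OF run Sn S(2), of w] w by blast
    then have "\<forall>i\<in>S. ev f i = w i" using Sn by (auto simp: ev_def)
    then show ?thesis using f(1) unfolding V_def by blast
  next
    case True
    define S' where "S' = S - {Suc n}"
    have fin: "finite S" using S(1) by (auto intro: finite_subset)
    have Sn: "S' \<subseteq> {..n}" using S(1) by (auto simp: S'_def less_Suc_eq_le le_Suc_eq)
    have card: "card S' \<le> t - 1" using True fin S(2) by (simp add: S'_def)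
    have "card S > 0" using True fin by (auto simp: card_gt_0_iff)
    then have t: "t > 0" using S(2) by simp
    \<comment> \<open>The extra coordinate costs one exponent, the last of the run. That exponent is
      at most m = max \<Delta>, so m lies outside the shortened run wherever the run ends.\<close>
    have "{a..<a + (t - 1)} \<subseteq> {a..<a + t}" by auto
    then have run': "{a..<a + (t - 1)} \<subseteq> \<Delta>" using run by (rule subset_trans)
    have "a + (t - 1) \<in> \<Delta>" using run t by auto
    then have notin: "m \<notin> {a..<a + (t - 1)}" using \<Delta>_lt(1)[of "a + (t - 1)"] by auto
    define c where "c = w (Suc n)"
    have c: "c \<in> carrier R" using w True by (simp add: c_def)
    \<comment> \<open>The term c X^m will produce the entry c at the extra coordinate; its values at
      the other points are subtracted in advance.\<close>
    have "w i \<ominus> c \<otimes> pt i [^] m \<in> carrier R" if "i \<in> S'" for i using w that c by (simp add: S'_def)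
    then obtain f where f: "\<forall>j\<in>\<Delta>. f j \<in> carrier R" "\<forall>i\<in>S'. val f (pt i) = w i \<ominus> c \<otimes> pt i [^] m"
      "f m = \<zero>"
      using interpolate_points[OF run' Sn card, of "\<lambda>i. w i \<ominus> c \<otimes> pt i [^] m"] notin by blast
    define g where "g a = (if a = m then \<one> else \<zero>)" for a
    define h where "h a = f a \<oplus> c \<otimes> g a" for a
    have g: "\<forall>a\<in>\<Delta>. g a \<in> carrier R" by (simp add: g_def)
    have h: "\<forall>a\<in>\<Delta>. h a \<in> carrier R" using f g c by (simp add: h_def)
    have "ev h i = w i" if i: "i \<in> S" for i
    proof (cases "i = Suc n")
      case True
      then show ?thesis using f(3) c by (simp add: ev_def h_def g_def c_def)
    next
      case False
      then have i': "i \<in> S'" using i by (simp add: S'_def)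
      then have le: "i \<le> n" using Sn by auto
      have "ev h i = val h (pt i)" using le by (simp add: ev_def)
      also have "\<dots> = val f (pt i) \<oplus> c \<otimes> val g (pt i)"
        unfolding h_def using f g c by (intro val_add_smult) auto
      also have "val g (pt i) = pt i [^] m"
        unfolding g_def using val_monomial[OF m_in_\<Delta> one_closed pt_closed[of i]] by simp
      also have "val f (pt i) = w i \<ominus> c \<otimes> pt i [^] m" using f(2) i' by blast
      finally show ?thesis using w i c by (simp add: minus_eq a_assoc l_neg)
    qed
    then show ?thesis using h unfolding V_def by blast
  qed
qed

text \<open>The values at the n + 1 points already determine the coefficients: evaluating all
  polynomials of degree at most n there is onto by Lagrange interpolation, hence injective by
  finiteness.\<close>

lemma card_V: "card V = card (carrier R) ^ card \<Delta>"
proof -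
  let ?P = "{..n} \<rightarrow>\<^sub>E carrier R"
  define \<Phi> where "\<Phi> h = (\<lambda>i\<in>{..n}. \<Oplus>j\<in>{..n}. h j \<otimes> pt i [^] j)" for h :: "nat \<Rightarrow> 'a"
  have "?P \<subseteq> \<Phi> ` ?P"
  proof
    fix w assume w: "w \<in> ?P"
    have inv: "inv_into {..n} pt (pt i) = i" if "i \<le> n" for i
      using that inj_pt by (intro inv_into_f_f) auto
    have "card (pt ` {..n}) \<le> Suc n" using card_image_le[of "{..n}" pt] by simp
    moreover have "w (inv_into {..n} pt x) \<in> carrier R" if "x \<in> pt ` {..n}" for x
      using that inv w by auto
    moreover have "finite (pt ` {..n})" "pt ` {..n} \<subseteq> carrier R" by auto
    ultimately have "\<exists>g. (\<forall>j. g j \<in> carrier R)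
        \<and> (\<forall>x\<in>pt ` {..n}. (\<Oplus>j\<in>{..<Suc n}. g j \<otimes> x [^] j) = w (inv_into {..n} pt x))"
      by (intro lagrange_interpolation)
    then obtain g where "\<forall>j. g j \<in> carrier R"
      and "\<forall>x\<in>pt ` {..n}. (\<Oplus>j\<in>{..<Suc n}. g j \<otimes> x [^] j) = w (inv_into {..n} pt x)" by blast
    then have g: "\<And>j. g j \<in> carrier R"
      and gw: "\<And>x. x \<in> pt ` {..n} \<Longrightarrow> (\<Oplus>j\<in>{..<Suc n}. g j \<otimes> x [^] j) = w (inv_into {..n} pt x)"
      by auto
    let ?h = "restrict g {..n}"
    have "\<Phi> ?h = w"
    proof (rule PiE_ext[of _ "{..n}" "\<lambda>_. carrier R"])
      show "w \<in> ?P" by (rule w)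
      show "\<Phi> ?h \<in> ?P" using g by (auto simp: \<Phi>_def intro!: finsum_closed)
      fix i assume i: "i \<in> {..n}"
      have "\<Phi> ?h i = (\<Oplus>j\<in>{..<Suc n}. g j \<otimes> pt i [^] j)"
        using i g unfolding lessThan_Suc_atMost by (auto simp: \<Phi>_def intro!: finsum_cong')
      then show "\<Phi> ?h i = w i" using gw[of "pt i"] i inv by simp
    qed
    then show "w \<in> \<Phi> ` ?P" using g by (intro image_eqI[of _ _ ?h]) auto
  qed
  then have inj\<Phi>: "inj_on \<Phi> ?P" using finite_R by (intro finite_surj_inj) (auto intro!: finite_PiE)
  \<comment> \<open>Extension by zero places coefficients on \<Delta> among those of all polynomials
    of degree at most n.\<close>
  define ext where "ext f = (\<lambda>j\<in>{..n}. if j \<in> \<Delta> then f j else \<zero>)" for f :: "nat \<Rightarrow> 'a"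
  have ext_P: "ext f \<in> ?P" if "\<forall>a\<in>\<Delta>. f a \<in> carrier R" for f using that by (auto simp: ext_def)
  have \<Delta>n: "\<Delta> \<subseteq> {..n}" using \<Delta>_lt(2) by fastforce
  have \<Phi>_ext: "\<Phi> (ext f) i = val f (pt i)" if f: "\<forall>a\<in>\<Delta>. f a \<in> carrier R" and i: "i \<le> n" for f i
  proof -
    have "\<Phi> (ext f) i = (\<Oplus>j\<in>{..n}. ext f j \<otimes> pt i [^] j)" using i by (simp add: \<Phi>_def)
    also have "\<dots> = (\<Oplus>j\<in>\<Delta>. f j \<otimes> pt i [^] j)"
      using f \<Delta>n by (intro add.finprod_mono_neutral_cong_right) (auto simp: ext_def)
    finally show ?thesis by (simp add: val_def)
  qed
  let ?D = "\<Delta> \<rightarrow>\<^sub>E carrier R"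
  have "inj_on ev ?D"
  proof (rule inj_onI)
    fix f g assume fg: "f \<in> ?D" "g \<in> ?D" and eq: "ev f = ev g"
    then have fc: "\<forall>a\<in>\<Delta>. f a \<in> carrier R" and gc: "\<forall>a\<in>\<Delta>. g a \<in> carrier R" by auto
    have "\<Phi> (ext f) i = \<Phi> (ext g) i" if i: "i \<le> n" for i
      using fun_cong[OF eq, of i] i fc gc by (simp add: \<Phi>_ext ev_def)
    then have "\<Phi> (ext f) = \<Phi> (ext g)" by (intro ext) (simp add: \<Phi>_def restrict_def)
    then have e: "ext f = ext g" using inj\<Phi> ext_P fc gc by (auto dest: inj_onD)
    have "f a = g a" if "a \<in> \<Delta>" for a
      using fun_cong[OF e, of a] that \<Delta>n by (auto simp: ext_def)
    then show "f = g" using fg by (blast intro: PiE_ext)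
  qed
  moreover have "ev ` ?D = V"
  proof
    show "ev ` ?D \<subseteq> V" unfolding V_def by auto
    show "V \<subseteq> ev ` ?D"
    proof
      fix v assume "v \<in> V"
      then obtain f where f: "\<forall>a\<in>\<Delta>. f a \<in> carrier R" "v = ev f" by (auto simp: V_def)
      have "val (restrict f \<Delta>) x = val f x" if "x \<in> carrier R" for x
        unfolding val_def using f that by (intro finsum_cong') auto
      then have "ev (restrict f \<Delta>) = ev f"
        unfolding ev_def using m_in_\<Delta> by (intro restrict_ext) simp
      then show "v \<in> ev ` ?D" using f by (intro image_eqI[of _ _ "restrict f \<Delta>"]) auto
    qed
  qed
  ultimately have "card V = card ?D" by (metis card_image)
  then show ?thesis using finite_\<Delta> by (simp add: card_funcsetE)
qed

section \<open>Descent to the subfield with q elements\<close>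

abbreviation "F \<equiv> fixed_by_power q"

definition C :: "(nat \<Rightarrow> 'a) set" where
  "C = V \<inter> (A \<rightarrow>\<^sub>E F)"

lemma subfield_F: "subfield F R"
  by (rule subfield_fixed_by_power[OF p char_p])

sublocale C: linear_code R F A C
proof (intro linear_code.intro linear_code_axioms.intro)
  show "field R" by (rule field_axioms)
  show "subfield F R" by (rule subfield_F)
  show "C \<subseteq> A \<rightarrow>\<^sub>E F" by (simp add: C_def)
  note F_closed = subringE[OF subfieldE(1)[OF subfield_F]]
  show "(\<lambda>i\<in>A. \<zero>) \<in> C" using V.zero_word F_closed(2) by (simp add: C_def PiE_def)
  fix u v c assume uv: "u \<in> C" "v \<in> C" "c \<in> F"
  have "c \<in> carrier R" using uv F_closed(1) by blast
  moreover have "u i \<oplus> c \<otimes> v i \<in> F" if "i \<in> A" for i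
  proof -
    have "u \<in> A \<rightarrow>\<^sub>E F" "v \<in> A \<rightarrow>\<^sub>E F" using uv by (auto simp: C_def)
    then have "u i \<in> F" "v i \<in> F" using that by (blast dest: PiE_mem)+
    then show ?thesis using uv(3) F_closed(6,7) by blast
  qed
  ultimately show "(\<lambda>i\<in>A. u i \<oplus> c \<otimes> v i) \<in> C"
    using V.combine[of u v c] uv by (auto simp: C_def)
qed simp

text \<open>The word of \<open>V\<close> with prescribed \<open>F\<close>-valued entries on an information set is unique, hence it
  is fixed by the Frobenius map.\<close>
lemma information_set_descends:
  assumes I: "V.information_set I"
  shows "C.information_set I"
proof -
  have IA: "I \<subseteq> A" using I by (simp add: V.information_set_def V.interpolates_def)
  have unique: "u = v" if "u \<in> V" "v \<in> V" "\<forall>i\<in>I. u i = v i" for u v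
    using I that unfolding V.information_set_def by blast
  have "\<exists>v\<in>C. \<forall>i\<in>I. v i = w i" if w: "\<forall>i\<in>I. w i \<in> F" for w
  proof -
    have "\<forall>i\<in>I. w i \<in> carrier R" using w by (simp add: fixed_by_power_def)
    then obtain v where v: "v \<in> V" "\<forall>i\<in>I. v i = w i"
      using I unfolding V.information_set_def V.interpolates_def by blast
    have "(\<lambda>i\<in>A. v i [^] q) i = v i" if "i \<in> I" for i
      using that IA v w by (auto simp: fixed_by_power_def)
    then have e: "(\<lambda>i\<in>A. v i [^] q) = v" using unique[OF V_frobenius[OF v(1)] v(1)] by blast
    have "v i \<in> F" if "i \<in> A" for i
      using fun_cong[OF e, of i] that V.word_closed[OF v(1) that] by (simp add: fixed_by_power_def)
    then have "v \<in> C" using v(1) V.V_sub by (auto simp: C_def)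
    then show ?thesis using v(2) by blast
  qed
  then have "C.interpolates I" unfolding C.interpolates_def using IA by simp
  moreover have "u = v" if "u \<in> C" "v \<in> C" "\<forall>i\<in>I. u i = v i" for u v
    using that unique[of u v] by (simp add: C_def)
  ultimately show ?thesis unfolding C.information_set_def by simp
qed

text \<open>A word of V with prescribed values on S may leave F elsewhere. Enlarging S to an
  information set and prescribing 0 on the new places pins the word down, and then it lies in
  C.\<close>

lemma C_interpolates:
  assumes run: "{a..<a + t} \<subseteq> \<Delta>" and S: "S \<subseteq> A" "card S \<le> t"
  shows "C.interpolates S"
proof -
  obtain I where I: "S \<subseteq> I" "V.information_set I"
    using V.information_set_extend[OF V_interpolates[OF run S]] .
  have "C.information_set I" by (rule information_set_descends[OF I(2)])
  then have intI: "C.interpolates I" by (simp add: C.information_set_def)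
  show ?thesis
    unfolding C.interpolates_def
  proof (intro conjI allI impI)
    fix w assume w: "\<forall>i\<in>S. w i \<in> F"
    have "\<exists>v\<in>C. \<forall>i\<in>I. v i = (if i \<in> S then w i else \<zero>)"
      by (rule C.interpolatesD[OF intI]) (simp add: w)
    then obtain v where "v \<in> C" "\<forall>i\<in>I. v i = (if i \<in> S then w i else \<zero>)" by blast
    then show "\<exists>v\<in>C. \<forall>i\<in>S. v i = w i" using I(1) by (intro bexI[of _ v]) auto
  qed (rule S(1))
qed

text \<open>An information set of V and the count of coefficients give two expressions for |V|; as K
  has at least two elements, their exponents agree.\<close>

lemma C_information_set:
  obtains I where "C.information_set I" "card I = card \<Delta>"
proof -
  obtain I where I: "V.information_set I"
    using V.information_set_extend[OF V.interpolates_empty] .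
  have "card (carrier R) ^ card I = card (carrier R) ^ card \<Delta>"
    using V.card_code[OF I] card_V by simp
  moreover have "card {\<zero>, \<one>} \<le> card (carrier R)" using finite_R by (intro card_mono) auto
  ultimately have "card I = card \<Delta>" by simp
  then show thesis using that information_set_descends[OF I] by blast
qed

lemma C_self_orthogonal: "C \<subseteq> C.dual"
  unfolding C.dual_def using V_self_orthogonal by (auto simp: C_def)

end

section \<open>The quantum code\<close>

text \<open>The multiplicative group is cyclic; raise a generator to the power (|K| - 1) /
  n.\<close>

lemma (in field) exists_element_of_order:
  assumes fin: "finite (carrier R)" and n: "n dvd card (carrier R) - 1"
  shows "\<exists>\<omega>\<in>carrier R. \<forall>j::nat. \<omega> [^] j = \<one> \<longleftrightarrow> n dvd j"
proof -
  interpret G: group "Multiplicative_Group.mult_of R" by (rule field_mult_group)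
  let ?q = "card (carrier R) - 1"
  have finG: "finite (carrier (Multiplicative_Group.mult_of R))" using fin by (rule finite_mult_of)
  have "card {\<zero>, \<one>} \<le> card (carrier R)" using fin by (intro card_mono) auto
  then have q: "?q > 0" by simp
  obtain a where a: "a \<in> carrier (Multiplicative_Group.mult_of R)" "carrier (Multiplicative_Group.mult_of R) = {a [^] i | i::nat. i \<in> UNIV}"
    using finite_field_mult_group_has_gen[OF fin] by blast
  have "generate (Multiplicative_Group.mult_of R) {a} = carrier (Multiplicative_Group.mult_of R)"
    using G.generate_pow_on_finite_carrier[OF finG a(1)] a(2) by (simp add: Multiplicative_Group.nat_pow_mult_of)
  then have "G.ord a = ?q"
    using G.generate_pow_card[OF a(1)] fin by (simp add: card_Diff_singleton)
  moreover obtain k where k: "?q = n * k" using n by blast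
  then have pos: "n > 0" "k > 0" using q by (auto intro: Nat.gr0I)
  have "?q div n dvd ?q" "?q div n \<noteq> 0" "?q div (?q div n) = n"
    unfolding k using pos by simp_all
  ultimately have ord: "G.ord (a [^] (?q div n)) = n"
    using G.ord_pow[OF a(1), of "?q div n"] by (simp add: Multiplicative_Group.nat_pow_mult_of)
  have "a [^] (?q div n) \<in> carrier (Multiplicative_Group.mult_of R)"
    using G.nat_pow_closed[OF a(1), of "?q div n"] by (simp add: Multiplicative_Group.nat_pow_mult_of)
  then show ?thesis
    using G.pow_eq_id[of "a [^] (?q div n)"] ord
    by (intro bexI[of _ "a [^] (?q div n)"]) (auto simp: Multiplicative_Group.nat_pow_mult_of)
qed

text \<open>Run lengths are bounded by the size of D and include 0, so the maximum is
  attained.\<close>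

lemma num_consecutive_run:
  assumes "finite D"
  obtains a where "{a..<a + num_consecutive D} \<subseteq> D"
proof -
  let ?L = "{l. \<exists>a. {a..<a + l} \<subseteq> D}"
  have "?L \<subseteq> {..card D}"
  proof
    fix l assume "l \<in> ?L"
    then obtain a where "{a..<a + l} \<subseteq> D" by blast
    then show "l \<in> {..card D}" using card_mono[OF assms, of "{a..<a + l}"] by simp
  qed
  then have "finite ?L" by (rule finite_subset) simp
  moreover have "?L \<noteq> {}" by (auto intro: exI[of _ 0])
  ultimately have "Max ?L \<in> ?L" by (rule Max_in)
  then have "\<exists>a. {a..<a + num_consecutive D} \<subseteq> D" by (simp add: num_consecutive_def)
  then show thesis using that by blast
qed

theorem proposition5p8:
  fixes p r q s N t :: nat
    and \<Delta> :: "nat set"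
    and \<C> :: "nat set set"
  assumes "prime p" and "p > 2" and "r \<ge> 1" and "q = p ^ r"
    and "s \<ge> 1"
    and "N > 1" and "odd N"
    and "(N - 1) dvd (q ^ s - 1)"
    and "p dvd N"
    and "\<And>C. C \<in> \<C> \<Longrightarrow> cyclotomic_set N q C"
    and "\<Delta> = \<Union>\<C>"
    and "0 \<in> \<Delta>"
    and "Max \<Delta> = (N - 1) div 2"
    and "t = num_consecutive \<Delta>"
  shows "\<exists>n \<kappa> \<delta> :: nat.
           n = N + 1 \<and>
           int \<kappa> = int N + 1 - 2 * int (card \<Delta>) \<and>
           \<delta> = t + 1 \<and>
           (\<exists>Q. qecc q n \<kappa> \<delta> Q)"
proof -
  define n where "n = N - 1"
  have N: "N = Suc n" and n: "even n" "n > 0" using assms(6,7) by (auto simp: n_def)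
  have "\<Delta> \<subseteq> {0..n}" using assms(10,11) by (auto simp: cyclotomic_set_def n_def)
  then have fin: "finite \<Delta>" by (rule finite_subset) simp
  have max: "Max \<Delta> = n div 2" using assms(13) by (simp add: n_def)
  have le: "\<Delta> \<subseteq> {..n div 2}" using Max_ge[OF fin] max by auto
  have m: "n div 2 \<in> \<Delta>" using Max_in[OF fin] assms(12) max by auto
  have closed: "(q * a) mod n \<in> \<Delta>" if a: "a \<in> \<Delta>" for a
  proof -
    have c: "cyc_mult N q a \<in> \<Delta>" using a assms(10,11) by (auto simp: cyclotomic_set_def)
    \<comment> \<open>Elements of \<Delta> are at most n / 2 < n, so the exceptional value N - 1 of
      \<open>cyc_mult\<close> cannot occur on \<Delta>, and multiplication is plain reduction modulo
      n.\<close>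
    have "n \<notin> \<Delta>" using le n by auto
    then show ?thesis
      using c assms(12) unfolding cyc_mult_def n_def[symmetric] by (auto split: if_splits)
  qed
  obtain K :: "((int list \<times> nat) multiset \<Rightarrow> int) ring"
    where K: "field K" "card (carrier K) = p ^ (r * s)" "[p] \<cdot>\<^bsub>K\<^esub> \<one>\<^bsub>K\<^esub> = \<zero>\<^bsub>K\<^esub>"
      "card (ring.fixed_by_power K (p ^ r)) = p ^ r"
    using finite_field_exists[OF assms(1,3,5)] .
  interpret K: field K by (rule K(1))
  have p0: "p > 0" using assms(2) by simp
  have finK: "finite (carrier K)" using K(2) p0 by (intro card_ge_0_finite) simp
  have "n dvd card (carrier K) - 1"
    using assms(4,8) K(2) by (simp add: n_def power_mult)
  then obtain \<omega> where \<omega>: "\<omega> \<in> carrier K" "\<And>j::nat. \<omega> [^]\<^bsub>K\<^esub> j = \<one>\<^bsub>K\<^esub> \<longleftrightarrow> n dvd j"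
    using K.exists_element_of_order[OF finK] by blast
  \<comment> \<open>n divides q^s - 1, which is coprime to q^s and therefore to q.\<close>
  have "coprime (p ^ r) n"
  proof -
    have "coprime (q ^ s) (q ^ s - 1)"
      using p0 assms(4) by (intro coprime_diff_one_right_nat) simp
    then have "coprime q (q ^ s - 1)" using assms(5) by simp
    then have "coprime q n"
      by (rule coprime_divisors[OF dvd_refl assms(8)[folded n_def]])
    then show ?thesis by (simp only: assms(4))
  qed
  moreover have "odd p" using prime_odd_nat[OF assms(1,2)] .
  ultimately interpret E: extended_evaluation_code K p r n \<omega> \<Delta>
    using finK K(3) assms(1,9,12) n \<omega> le m closed[unfolded assms(4)]
    by unfold_locales (simp_all add: N)
  obtain a where a: "{a..<a + t} \<subseteq> \<Delta>" using num_consecutive_run[OF fin] assms(14) by blast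
  obtain I where I: "E.C.information_set I" "card I = card \<Delta>" by (rule E.C_information_set)
  have cardF: "card (K.fixed_by_power (p ^ r)) = q" using K(4) assms(4) by simp
  have finF: "finite (K.fixed_by_power (p ^ r))"
    using finK by (rule rev_finite_subset) (auto simp: K.fixed_by_power_def)
  have "\<exists>Q. qecc q (Suc (Suc n)) (Suc (Suc n) - 2 * card I) (t + 1) Q"
    by (rule qecc_of_self_orthogonal_code[OF E.C.linear_code_axioms finF cardF E.C_self_orthogonal I(1)])
       (auto intro: E.C_interpolates[OF a])
  \<comment> \<open>\<Delta> lies in {0, ..., (N - 1) / 2}, so 2 |\<Delta>| <= N + 1 and the
    subtraction of natural numbers agrees with the integer one.\<close>
  moreover have "card \<Delta> \<le> Suc (n div 2)" using card_mono[OF _ le] by simp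
  then have "2 * card \<Delta> \<le> N + 1" using n N by auto
  ultimately show ?thesis using N I(2)
    by (intro exI[of _ "N + 1"] exI[of _ "N + 1 - 2 * card \<Delta>"] exI[of _ "t + 1"]) auto
qed

end
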